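(* Let $\mathcal{A}=\bigcup_\alpha X_\alpha$ be a unital strong algebra, and let $$\mathcal{U}=\left\{a(t)=\sum_{n=-\infty}^\infty a_ne^{int}:\ \sum_{n=-\infty}^\infty\|a_n\|_\alpha<\infty\text{ for some }\alpha\right\}$$ be the associated Wiener algebra. Denote $$\mathcal{U}^+=\{a\in\mathcal{U}: a_n=0\ \ \forall n\ge 0\},\qquad \mathcal{U}^-_0=\{a\in\mathcal{U}: a_n=0\ \ \forall n<0\}.$$ Then any $a\in\mathcal{U}$ which is close enough to the identity, in the sense that there exist $\alpha\in A$ and $\beta\ge h(\alpha)$ such that $$A_{\beta,\alpha}\|1-a\|_\alpha<1,$$ admits a canonical factorization with respect to $\mathcal{U}^+$ and $\mathcal{U}^-_0$.
   Context: Inductive limit of Banach spaces: a complex vector space $X$ with a family $\{X_\alpha:\alpha\in A\}$ of subspaces, $X_\alpha\ne X_\beta$ for $\alpha\neq\beta$, directed under inclusion, with $X=\bigcup_\alpha X_\alpha$; the index set $A$ is directed by $\alpha\le\beta$ iff $X_\alpha\subseteq X_\beta$. Each $X_\alpha$ is a Banach space with norm $\|\cdot\|_\alpha$, and whenever $\alpha\le\beta$ the topology induced by $\|\cdot\|_\beta$ on $X_\alpha$ is coarser than that induced by $\|\cdot\|_\alpha$. $X$ carries the inductive limit topology: the finest locally convex topology making all inclusions $X_\alpha\hookrightarrow X$ continuous. Strong algebra: an inductive limit $\mathcal{A}=\bigcup_{\alpha\in A} X_\alpha$ of Banach spaces which is also an (associative) algebra such that for any $\alpha\in A$ there exists $h(\alpha)\in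 A$ such that for any $\beta\ge h(\alpha)$ there is a positive constant $A_{\beta,\alpha}$ with $\|ab\|_\beta\le A_{\beta,\alpha}\|a\|_\alpha\|b\|_\beta$ and $\|ba\|_\beta\le A_{\beta,\alpha}\|a\|_\alpha\|b\|_\beta$ for every $a\in X_\alpha$, $b\in X_\beta$. The map $h$ and constants $A_{\beta,\alpha}$ are fixed. Unital means that $\mathcal{A}$ has a multiplicative unit $1$ (a standing assumption of the paper). Wiener algebra associated to $\mathcal{A}$: $Y_\alpha$ is the Banach space of periodic functions $a(t)=\sum_{n\in\mathbb{Z}}a_ne^{int}$, $a_n\in X_\alpha$, on $-\pi\le t<\pi$ to $\mathcal{A}$, with $\|a\|_\alpha=\sum_{n\in\mathbb{Z}}\|a_n\|_\alpha<\infty$; $\mathcal{U}=\bigcup_\alpha Y_\alpha$ is the inductive limit of the Banach spaces $Y_\alpha$, with pointwise multiplication. It is a strong algebra with the same $h$ and $A_{\beta,\alpha}$. Writing $\|x\|_\alpha$ for $x\in\mathcal{U}$ presupposes $x\in Y_\alpha$. Canonical factorization of $a\in GL(\mathcal{U})$ (the invertible elements of $\mathcal{U}$) with respect to $\mathcal{U}^+$ and $\mathcal{U}^-_0$: $a=a_-a_+$ where $a_-,a_+\in GL(\mathcal{U})$ satisfy $a_+-1,\ a_+^{-1}-1\in\mathcal{U}^+$ and $a_--1,\ a_-^{-1}-1\in\mathcal{U}^-_0$.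
   Formalization: The formal theorem also assumes that 1−a has coefficients summable in the β-norm (1−a ∈ Y_β); this is automatic if β ≥ α or 1 ∈ X_β, but for an arbitrary map h the claim without it is false. *)

theory Defs
  imports "HOL-Analysis.Analysis" "HOL-Library.Function_Algebras"
begin

section \<open>Banach spaces inside an ambient complex vector space\<close>

text \<open>
  All spaces of an inductive limit are subspaces of one ambient space, each with its own norm; a norm
  is a function on the whole type whose values outside the subspace are irrelevant. Since the locale
  \<^locale>\<open>Metric_space\<close> wants a nonnegative symmetric distance on the whole type, the distance
  is cut off outside the subspace.
\<close>

definition norm_dist :: "'a::ab_group_add set \<Rightarrow> ('a \<Rightarrow> real) \<Rightarrow> 'a \<Rightarrow> 'a \<Rightarrow> real" where
  "norm_dist S N x y = (if x \<in> S \<and> y \<in> S then N (x - y) else 0)"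

definition norm_topology :: "'a::ab_group_add set \<Rightarrow> ('a \<Rightarrow> real) \<Rightarrow> 'a topology" where
  "norm_topology S N = Metric_space.mtopology S (norm_dist S N)"

locale banach_subspace = vector_space scale
  for scale :: "complex \<Rightarrow> 'a::ab_group_add \<Rightarrow> 'a" +
  fixes S :: "'a set" and N :: "'a \<Rightarrow> real"
  assumes subspace_S: "subspace S"
    and N_nonneg: "x \<in> S \<Longrightarrow> 0 \<le> N x"
    and N_eq_0: "x \<in> S \<Longrightarrow> N x = 0 \<longleftrightarrow> x = 0"
    and N_scale: "x \<in> S \<Longrightarrow> N (scale c x) = cmod c * N x"
    and N_triangle: "x \<in> S \<Longrightarrow> y \<in> S \<Longrightarrow> N (x + y) \<le> N x + N y"
    and complete: "Metric_space.mcomplete S (norm_dist S N)"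

context banach_subspace begin

lemma S_closed:
  shows zero_S: "0 \<in> S" and add_S: "x \<in> S \<Longrightarrow> y \<in> S \<Longrightarrow> x + y \<in> S"
    and scale_S: "x \<in> S \<Longrightarrow> scale c x \<in> S" and diff_S: "x \<in> S \<Longrightarrow> y \<in> S \<Longrightarrow> x - y \<in> S"
    and sum_S: "(\<And>i. i \<in> I \<Longrightarrow> f i \<in> S) \<Longrightarrow> sum f I \<in> S"
  by (auto intro: subspace_S subspace_0 subspace_add subspace_scale subspace_diff subspace_sum)

lemma N_minus: "x \<in> S \<Longrightarrow> N (- x) = N x"
  using N_scale[of x "-1"] by simp

lemma N_diff_triangle: "x \<in> S \<Longrightarrow> y \<in> S \<Longrightarrow> N (x - y) \<le> N x + N y"
  using N_triangle[of x "-y"] N_minus[of y] subspace_neg[OF subspace_S] by simp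

lemma N_sum: "(\<And>i. i \<in> I \<Longrightarrow> f i \<in> S) \<Longrightarrow> N (sum f I) \<le> (\<Sum>i\<in>I. N (f i))"
proof (induction I rule: infinite_finite_induct)
  case (insert i I)
  have "N (f i + sum f I) \<le> N (f i) + N (sum f I)"
    by (intro N_triangle sum_S) (use insert.prems in auto)
  then show ?case using insert by force
qed (use N_eq_0[of 0] zero_S in auto)

lemma metric: "Metric_space S (norm_dist S N)"
proof
  fix x y z
  show "0 \<le> norm_dist S N x y" by (auto simp: norm_dist_def intro!: N_nonneg diff_S)
  show "norm_dist S N x y = norm_dist S N y x"
    using N_minus[of "x - y"] diff_S[of x y] by (auto simp: norm_dist_def)
  show "norm_dist S N x y = 0 \<longleftrightarrow> x = y" if "x \<in> S" "y \<in> S"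
    using that N_eq_0[of "x - y"] diff_S by (auto simp: norm_dist_def)
  show "norm_dist S N x z \<le> norm_dist S N x y + norm_dist S N y z"
    if "x \<in> S" "y \<in> S" "z \<in> S"
    using that N_triangle[of "x - y" "y - z"] diff_S by (auto simp: norm_dist_def)
qed

lemma limitin_norm_topology:
  "limitin (norm_topology S N) f l F \<longleftrightarrow>
     l \<in> S \<and> (\<forall>e>0. \<forall>\<^sub>F x in F. f x \<in> S \<and> N (f x - l) < e)"
  unfolding norm_topology_def Metric_space.limitin_metric[OF metric]
  by (rule conj_cong[OF refl]) (auto simp: norm_dist_def elim!: eventually_mono)

end


section \<open>Inductive limits of Banach spaces and strong algebras\<close>

text \<open>
  The index set is the type \<open>'i\<close>, and \<open>\<alpha> \<le> \<beta>\<close> is \<open>X \<alpha> \<subseteq> X \<beta>\<close>. The inductive limit topology is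
  determined by these data.
\<close>

locale banach_inductive_limit = vector_space scale
  for scale :: "complex \<Rightarrow> 'a::ab_group_add \<Rightarrow> 'a" +
  fixes X :: "'i \<Rightarrow> 'a set" and nrm :: "'i \<Rightarrow> 'a \<Rightarrow> real"
  assumes banach: "banach_subspace scale (X \<alpha>) (nrm \<alpha>)"
    and distinct_spaces: "\<alpha> \<noteq> \<beta> \<Longrightarrow> X \<alpha> \<noteq> X \<beta>"
    and directed: "\<exists>\<gamma>. X \<alpha> \<subseteq> X \<gamma> \<and> X \<beta> \<subseteq> X \<gamma>"
    and union: "(\<Union>\<alpha>. X \<alpha>) = UNIV"
    and coarser: "X \<alpha> \<subseteq> X \<beta> \<Longrightarrow> openin (subtopology (norm_topology (X \<beta>) (nrm \<beta>)) (X \<alpha>)) V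
                  \<Longrightarrow> openin (norm_topology (X \<alpha>) (nrm \<alpha>)) V"

text \<open>
  The sort of \<open>'a\<close> makes it an associative ring with unit, without excluding \<open>1 = 0\<close>. The order of
  indices in \<open>A \<beta> \<alpha>\<close> is that of the constants \<open>A\<^sub>\<beta>\<^sub>,\<^sub>\<alpha>\<close>. The bounds on \<open>a * b\<close> and \<open>b * a\<close> in the
  norm of \<open>X \<beta>\<close> include that these products lie in \<open>X \<beta>\<close>.
\<close>

locale unital_strong_algebra = banach_inductive_limit scale X nrm
  for scale :: "complex \<Rightarrow> 'a::{ring, monoid_mult} \<Rightarrow> 'a"
    and X :: "'i \<Rightarrow> 'a set" and nrm :: "'i \<Rightarrow> 'a \<Rightarrow> real" +
  fixes h :: "'i \<Rightarrow> 'i" and A :: "'i \<Rightarrow> 'i \<Rightarrow> real"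
  assumes scale_mult_left: "scale c x * y = scale c (x * y)"
    and scale_mult_right: "x * scale c y = scale c (x * y)"
    and A_pos: "X (h \<alpha>) \<subseteq> X \<beta> \<Longrightarrow> 0 < A \<beta> \<alpha>"
    and mult_left: "X (h \<alpha>) \<subseteq> X \<beta> \<Longrightarrow> a \<in> X \<alpha> \<Longrightarrow> b \<in> X \<beta> \<Longrightarrow>
          a * b \<in> X \<beta> \<and> nrm \<beta> (a * b) \<le> A \<beta> \<alpha> * nrm \<alpha> a * nrm \<beta> b"
    and mult_right: "X (h \<alpha>) \<subseteq> X \<beta> \<Longrightarrow> a \<in> X \<alpha> \<Longrightarrow> b \<in> X \<beta> \<Longrightarrow>
          b * a \<in> X \<beta> \<and> nrm \<beta> (b * a) \<le> A \<beta> \<alpha> * nrm \<alpha> a * nrm \<beta> b"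


section \<open>The associated Wiener algebra\<close>

text \<open>
  Elements are functions of \<open>t\<close> on the real line (the series makes them \<open>2\<pi>\<close>-periodic), with the
  pointwise ring operations of \<^theory>\<open>HOL-Library.Function_Algebras\<close>; in particular \<open>1\<close>
  is the constant function \<open>1\<close>.
\<close>

context banach_inductive_limit
begin

definition wiener_series :: "'i \<Rightarrow> (int \<Rightarrow> 'a) \<Rightarrow> (real \<Rightarrow> 'a) \<Rightarrow> bool" where
  "wiener_series \<alpha> c a \<longleftrightarrow>
     (\<forall>n. c n \<in> X \<alpha>) \<and> (\<lambda>n. nrm \<alpha> (c n)) summable_on UNIV \<and>
     (\<forall>t. limitin (norm_topology (X \<alpha>) (nrm \<alpha>))
            (\<lambda>F. \<Sum>n\<in>F. scale (exp (\<i> * of_int n * of_real t)) (c n)) (a t)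
            (finite_subsets_at_top UNIV))"

definition wiener_space :: "'i \<Rightarrow> (real \<Rightarrow> 'a) set" where
  "wiener_space \<alpha> = {a. \<exists>c. wiener_series \<alpha> c a}"

definition wiener_algebra :: "(real \<Rightarrow> 'a) set" where
  "wiener_algebra = (\<Union>\<alpha>. wiener_space \<alpha>)"

definition fourier_coeff :: "(real \<Rightarrow> 'a) \<Rightarrow> int \<Rightarrow> 'a" where
  "fourier_coeff a = (THE c. \<exists>\<alpha>. wiener_series \<alpha> c a)"

definition wiener_norm :: "'i \<Rightarrow> (real \<Rightarrow> 'a) \<Rightarrow> real" where
  "wiener_norm \<alpha> a = (\<Sum>\<^sub>\<infinity>n. nrm \<alpha> (fourier_coeff a n))"

text \<open>The signs follow the source: the plus part has the strictly negative frequencies.\<close>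

definition wiener_plus :: "(real \<Rightarrow> 'a) set" where
  "wiener_plus = {a \<in> wiener_algebra. \<forall>n\<ge>0. fourier_coeff a n = 0}"

definition wiener_minus0 :: "(real \<Rightarrow> 'a) set" where
  "wiener_minus0 = {a \<in> wiener_algebra. \<forall>n<0. fourier_coeff a n = 0}"

end

text \<open>
  The Fourier coefficients are unique, also across different indices, so the definite description
  in \<open>fourier_coeff\<close> is well defined.
\<close>

context banach_inductive_limit begin

lemma inclusion_bounded:
  assumes "X \<alpha> \<subseteq> X \<beta>"
  obtains C where "C > 0" "\<And>x. x \<in> X \<alpha> \<Longrightarrow> nrm \<beta> x \<le> C * nrm \<alpha> x"
proof -
  interpret a: banach_subspace scale "X \<alpha>" "nrm \<alpha>" by (rule banach)
  interpret b: banach_subspace scale "X \<beta>" "nrm \<beta>" by (rule banach)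
  interpret am: Metric_space "X \<alpha>" "norm_dist (X \<alpha>) (nrm \<alpha>)" by (rule a.metric)
  interpret bm: Metric_space "X \<beta>" "norm_dist (X \<beta>) (nrm \<beta>)" by (rule b.metric)
  have "openin (norm_topology (X \<alpha>) (nrm \<alpha>)) (bm.mball 0 1 \<inter> X \<alpha>)"
    by (rule coarser[OF assms]) (auto simp: openin_subtopology norm_topology_def)
  moreover have "0 \<in> bm.mball 0 1 \<inter> X \<alpha>"
    using a.zero_S b.zero_S by auto
  ultimately obtain r where r: "r > 0" "am.mball 0 r \<subseteq> bm.mball 0 1 \<inter> X \<alpha>"
    unfolding norm_topology_def am.openin_mtopology by blast
  have small: "nrm \<beta> x < 1" if "x \<in> X \<alpha>" "nrm \<alpha> x < r" for x
  proof -
    have "x \<in> am.mball 0 r" using that a.zero_S a.N_minus[of x] by (auto simp: norm_dist_def)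
    then have "x \<in> bm.mball 0 1" using r by blast
    then show ?thesis using b.N_minus[of x] b.zero_S by (auto simp: norm_dist_def)
  qed
  show thesis
  proof
    show "2 / r > 0" using r by simp
    fix x assume x: "x \<in> X \<alpha>"
    show "nrm \<beta> x \<le> 2 / r * nrm \<alpha> x"
    proof (cases "x = 0")
      case True
      then show ?thesis using a.N_eq_0[of 0] b.N_eq_0[of 0] a.zero_S b.zero_S by simp
    next
      case False
      have p: "nrm \<alpha> x > 0" using a.N_nonneg[OF x] a.N_eq_0[OF x] False by linarith
      define s where "s = r / (2 * nrm \<alpha> x)"
      have s: "s > 0" using p r by (simp add: s_def)
      have "nrm \<alpha> (scale (of_real s) x) = r / 2"
        unfolding a.N_scale[OF x] norm_of_real using s p r by (simp add: s_def)
      then have "nrm \<beta> (scale (of_real s) x) < 1"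
        using small[of "scale (of_real s) x"] a.scale_S[OF x] r by simp
      then have "s * nrm \<beta> x < 1"
        using b.N_scale[of x "of_real s"] x assms s by auto
      then show ?thesis using s p r by (simp add: s_def field_simps)
    qed
  qed
qed

lemma wiener_series_mono:
  assumes "wiener_series \<alpha> c a" and sub: "X \<alpha> \<subseteq> X \<beta>"
  shows "wiener_series \<beta> c a"
proof -
  interpret a: banach_subspace scale "X \<alpha>" "nrm \<alpha>" by (rule banach)
  interpret b: banach_subspace scale "X \<beta>" "nrm \<beta>" by (rule banach)
  obtain C where C: "C > 0" "\<And>x. x \<in> X \<alpha> \<Longrightarrow> nrm \<beta> x \<le> C * nrm \<alpha> x"
    using inclusion_bounded[OF sub] by blast
  have c: "\<And>n. c n \<in> X \<alpha>" and sm: "(\<lambda>n. nrm \<alpha> (c n)) summable_on UNIV"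
    and lim: "\<And>t. limitin (norm_topology (X \<alpha>) (nrm \<alpha>))
            (\<lambda>F. \<Sum>n\<in>F. scale (exp (\<i> * of_int n * of_real t)) (c n)) (a t)
            (finite_subsets_at_top UNIV)"
    using assms unfolding wiener_series_def by auto
  have "(\<lambda>n. nrm \<beta> (c n)) summable_on UNIV"
  proof (rule summable_on_comparison_test)
    show "(\<lambda>n. C * nrm \<alpha> (c n)) summable_on UNIV" using sm by (rule summable_on_cmult_right)
  qed (use C c sub b.N_nonneg in auto)
  moreover have "limitin (norm_topology (X \<beta>) (nrm \<beta>))
            (\<lambda>F. \<Sum>n\<in>F. scale (exp (\<i> * of_int n * of_real t)) (c n)) (a t)
            (finite_subsets_at_top UNIV)" for t
    unfolding b.limitin_norm_topology
  proof (intro conjI allI impI)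
    have at: "a t \<in> X \<alpha>" using lim[of t] by (simp add: a.limitin_norm_topology)
    then show "a t \<in> X \<beta>" using sub by blast
    fix e :: real assume "e > 0"
    then have "e / C > 0" using C by simp
    then have "\<forall>\<^sub>F F in finite_subsets_at_top UNIV.
        (\<Sum>n\<in>F. scale (exp (\<i> * of_int n * of_real t)) (c n)) \<in> X \<alpha> \<and>
        nrm \<alpha> ((\<Sum>n\<in>F. scale (exp (\<i> * of_int n * of_real t)) (c n)) - a t) < e / C"
      using lim[of t] by (simp add: a.limitin_norm_topology)
    then show "\<forall>\<^sub>F F in finite_subsets_at_top UNIV.
        (\<Sum>n\<in>F. scale (exp (\<i> * of_int n * of_real t)) (c n)) \<in> X \<beta> \<and>
        nrm \<beta> ((\<Sum>n\<in>F. scale (exp (\<i> * of_int n * of_real t)) (c n)) - a t) < e"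
    proof eventually_elim
      case (elim F)
      have "nrm \<beta> ((\<Sum>n\<in>F. scale (exp (\<i> * of_int n * of_real t)) (c n)) - a t)
          \<le> C * nrm \<alpha> ((\<Sum>n\<in>F. scale (exp (\<i> * of_int n * of_real t)) (c n)) - a t)"
        using elim at a.diff_S by (intro C) auto
      also have "\<dots> < e" using elim C by (simp add: field_simps)
      finally show ?case using elim sub by auto
    qed
  qed
  ultimately show ?thesis using c sub unfolding wiener_series_def by auto
qed

lemma roots_sum:
  assumes "m \<noteq> 0" "\<bar>m\<bar> < int K"
  shows "(\<Sum>j<K. exp (\<i> * of_int m * of_real (2 * pi * real j / real K))) = 0"
proof -
  define z where "z = exp (\<i> * of_int m * of_real (2 * pi / real K))"
  have K: "K > 0" using assms by auto
  have eq: "exp (\<i> * of_int m * of_real (2 * pi * real j / real K)) = z ^ j" for j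
    unfolding z_def exp_of_nat_mult[symmetric] by (simp add: field_simps)
  have "z \<noteq> 1"
  proof
    assume "z = 1"
    then obtain l :: int where "of_int m * (2 * pi / real K) = of_int (2 * l) * pi"
      unfolding z_def exp_eq_1 by (auto simp: Re_exp Im_exp)
    then have "real_of_int m = real_of_int (l * int K)" using K by (simp add: field_simps)
    then have "m = l * int K" by linarith
    then have "int K dvd m" by simp
    then show False using assms dvd_imp_le_int[of m "int K"] by auto
  qed
  moreover have "z ^ K = 1"
  proof -
    have "z ^ K = exp (\<i> * of_int m * of_real (2 * pi))"
      unfolding z_def exp_of_nat_mult[symmetric] using K by (simp add: field_simps)
    also have "\<dots> = 1" by (subst exp_eq_1) (auto intro!: exI[of _ m])
    finally show ?thesis .
  qed
  ultimately show ?thesis unfolding eq using geometric_sum[of z K] by simp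
qed

lemma wiener_series_unique:
  assumes "wiener_series \<alpha> c a" "wiener_series \<beta> d a"
  shows "c = d"
proof
  fix k
  obtain \<gamma> where sub: "X \<alpha> \<subseteq> X \<gamma>" "X \<beta> \<subseteq> X \<gamma>" using directed by blast
  interpret g: banach_subspace scale "X \<gamma>" "nrm \<gamma>" by (rule banach)
  have c: "wiener_series \<gamma> c a" and d: "wiener_series \<gamma> d a"
    using assms sub wiener_series_mono by auto
  define u where "u n = c n - d n" for n
  define E :: "int \<Rightarrow> real \<Rightarrow> complex" where "E n t = exp (\<i> * of_int n * of_real t)" for n t
  have cX: "c n \<in> X \<gamma>" "d n \<in> X \<gamma>" for n using c d unfolding wiener_series_def by auto
  then have uX: "u n \<in> X \<gamma>" for n by (simp add: u_def g.diff_S)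
  have sumX: "(\<Sum>n\<in>F. scale (E n t) (u n)) \<in> X \<gamma>" for F t
    by (intro g.sum_S g.scale_S uX)
  have E1: "cmod (E n t) = 1" for n t by (simp add: E_def)
  have "(\<lambda>n. nrm \<gamma> (c n) + nrm \<gamma> (d n)) summable_on UNIV"
    using c d unfolding wiener_series_def by (intro summable_on_add) auto
  then have su: "(\<lambda>n. nrm \<gamma> (u n)) summable_on UNIV"
    by (rule summable_on_comparison_test) (auto simp: u_def cX g.diff_S g.N_nonneg g.N_diff_triangle)
  have lim: "\<forall>\<^sub>F F in finite_subsets_at_top UNIV. nrm \<gamma> (\<Sum>n\<in>F. scale (E n t) (u n)) < e"
    if "e > 0" for t e
  proof -
    have lc: "limitin (norm_topology (X \<gamma>) (nrm \<gamma>)) (\<lambda>F. \<Sum>n\<in>F. scale (E n t) (c n)) (a t)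
                (finite_subsets_at_top UNIV)"
      and ld: "limitin (norm_topology (X \<gamma>) (nrm \<gamma>)) (\<lambda>F. \<Sum>n\<in>F. scale (E n t) (d n)) (a t)
                (finite_subsets_at_top UNIV)"
      using c d unfolding wiener_series_def E_def by blast+
    have at: "a t \<in> X \<gamma>" using lc by (simp add: g.limitin_norm_topology)
    have e2: "e/2 > 0" using that by simp
    have "\<forall>\<^sub>F F in finite_subsets_at_top UNIV. (\<Sum>n\<in>F. scale (E n t) (c n)) \<in> X \<gamma> \<and>
            nrm \<gamma> ((\<Sum>n\<in>F. scale (E n t) (c n)) - a t) < e/2"
      and "\<forall>\<^sub>F F in finite_subsets_at_top UNIV. (\<Sum>n\<in>F. scale (E n t) (d n)) \<in> X \<gamma> \<and>
            nrm \<gamma> ((\<Sum>n\<in>F. scale (E n t) (d n)) - a t) < e/2"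
      using lc ld e2 unfolding g.limitin_norm_topology by blast+
    then show ?thesis
    proof eventually_elim
      case (elim F)
      have eq: "(\<Sum>n\<in>F. scale (E n t) (u n)) =
         ((\<Sum>n\<in>F. scale (E n t) (c n)) - a t) - ((\<Sum>n\<in>F. scale (E n t) (d n)) - a t)"
        by (simp add: u_def scale_right_diff_distrib sum_subtractf)
      show ?case unfolding eq
        using g.N_diff_triangle[of "(\<Sum>n\<in>F. scale (E n t) (c n)) - a t"
            "(\<Sum>n\<in>F. scale (E n t) (d n)) - a t"] elim g.diff_S at by force
    qed
  qed
  have "nrm \<gamma> (u k) \<le> e" if e: "e > 0" for e
  proof -
    obtain F0 where F0: "finite F0"
      and F0': "\<And>G. finite G \<Longrightarrow> F0 \<subseteq> G \<Longrightarrow> dist (\<Sum>n\<in>G. nrm \<gamma> (u n)) (\<Sum>\<^sub>\<infinity>n. nrm \<gamma> (u n)) < e/4"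
    proof -
      have "((\<lambda>F. \<Sum>n\<in>F. nrm \<gamma> (u n)) \<longlongrightarrow> (\<Sum>\<^sub>\<infinity>n. nrm \<gamma> (u n))) (finite_subsets_at_top UNIV)"
        using has_sum_infsum[OF su] by (simp add: has_sum_def)
      moreover have "e/4 > 0" using e by simp
      ultimately have "\<forall>\<^sub>F F in finite_subsets_at_top UNIV.
          dist (\<Sum>n\<in>F. nrm \<gamma> (u n)) (\<Sum>\<^sub>\<infinity>n. nrm \<gamma> (u n)) < e/4"
        by (rule tendstoD)
      then show thesis using that unfolding eventually_finite_subsets_at_top by auto
    qed
    define F where "F = insert k F0"
    have F: "finite F" "k \<in> F" using F0 by (auto simp: F_def)
    have tail: "(\<Sum>n\<in>G - F. nrm \<gamma> (u n)) < e/2" if "finite G" "F \<subseteq> G" for G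
    proof -
      have "(\<Sum>n\<in>G - F. nrm \<gamma> (u n)) = (\<Sum>n\<in>G. nrm \<gamma> (u n)) - (\<Sum>n\<in>F. nrm \<gamma> (u n))"
        using that by (simp add: sum_diff)
      moreover have "dist (\<Sum>n\<in>G. nrm \<gamma> (u n)) (\<Sum>\<^sub>\<infinity>n. nrm \<gamma> (u n)) < e/4"
        "dist (\<Sum>n\<in>F. nrm \<gamma> (u n)) (\<Sum>\<^sub>\<infinity>n. nrm \<gamma> (u n)) < e/4"
        using F0' that F by (auto simp: F_def)
      ultimately show ?thesis unfolding dist_real_def by linarith
    qed
    have small: "nrm \<gamma> (\<Sum>n\<in>F. scale (E n t) (u n)) \<le> e" for t
    proof -
      have "\<forall>\<^sub>F G in finite_subsets_at_top UNIV. finite G \<and> F \<subseteq> G"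
        using F by (auto simp: eventually_finite_subsets_at_top)
      then have "\<forall>\<^sub>F G in finite_subsets_at_top UNIV.
          finite G \<and> F \<subseteq> G \<and> nrm \<gamma> (\<Sum>n\<in>G. scale (E n t) (u n)) < e/2"
        using lim[of "e/2" t] e by (auto elim: eventually_elim2)
      then obtain G where G: "finite G" "F \<subseteq> G" "nrm \<gamma> (\<Sum>n\<in>G. scale (E n t) (u n)) < e/2"
        using eventually_happens'[OF finite_subsets_at_top_neq_bot] by blast
      have "(\<Sum>n\<in>F. scale (E n t) (u n)) =
          (\<Sum>n\<in>G. scale (E n t) (u n)) - (\<Sum>n\<in>G-F. scale (E n t) (u n))"
        using G by (simp add: sum_diff)
      moreover have "nrm \<gamma> (\<Sum>n\<in>G-F. scale (E n t) (u n)) \<le> (\<Sum>n\<in>G-F. nrm \<gamma> (u n))"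
        using g.N_sum[of "G-F" "\<lambda>n. scale (E n t) (u n)"] uX g.scale_S g.N_scale E1 by simp
      ultimately show ?thesis using G tail[OF G(1,2)] g.N_diff_triangle[OF sumX sumX, of t G t "G-F"] by simp
    qed
    define K where "K = Suc (\<Sum>n\<in>F. nat \<bar>n - k\<bar>)"
    have K: "\<bar>n - k\<bar> < int K" if "n \<in> F" for n
      using member_le_sum[of n F "\<lambda>n. nat \<bar>n - k\<bar>"] that F unfolding K_def by (simp del: of_nat_sum)
    have K0: "K > 0" by (simp add: K_def)
    define T where "T j = 2 * pi * real j / real K" for j
    have "scale (of_nat K) (u k) = (\<Sum>n\<in>F. scale (\<Sum>j<K. E (n - k) (T j)) (u n))"
    proof -
      have z: "(\<Sum>j<K. E (n - k) (T j)) = (if n = k then of_nat K else 0)" if "n \<in> F" for n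
        using roots_sum[of "n - k" K] K[OF that] by (auto simp: E_def T_def)
      have "(\<Sum>n\<in>F. scale (\<Sum>j<K. E (n - k) (T j)) (u n)) =
            (\<Sum>n\<in>F. if n = k then scale (of_nat K) (u n) else 0)"
        by (intro sum.cong refl) (use z in auto)
      then show ?thesis using F by simp
    qed
    also have "\<dots> = (\<Sum>j<K. \<Sum>n\<in>F. scale (E (n - k) (T j)) (u n))"
      unfolding scale_sum_left by (rule sum.swap)
    also have "\<dots> = (\<Sum>j<K. scale (E (-k) (T j)) (\<Sum>n\<in>F. scale (E n (T j)) (u n)))"
      unfolding scale_sum_right scale_scale
      by (intro sum.cong refl) (simp add: E_def exp_add[symmetric] algebra_simps)
    finally have eq: "scale (of_nat K) (u k) = \<dots>" .
    have "real K * nrm \<gamma> (u k) = nrm \<gamma> (scale (of_nat K) (u k))"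
      using g.N_scale[OF uX] by simp
    also have "\<dots> \<le> (\<Sum>j<K. nrm \<gamma> (scale (E (-k) (T j)) (\<Sum>n\<in>F. scale (E n (T j)) (u n))))"
      unfolding eq by (intro g.N_sum g.scale_S sumX)
    also have "\<dots> \<le> (\<Sum>j<K. e)"
      by (intro sum_mono) (simp add: g.N_scale[OF sumX] E1 small)
    finally show ?thesis using K0 by simp
  qed
  then have "nrm \<gamma> (u k) \<le> 0" by (rule field_le_epsilon[where y=0, simplified])
  then have "u k = 0" using g.N_nonneg[OF uX, of k] g.N_eq_0[OF uX, of k] by auto
  then show "c k = d k" by (simp add: u_def)
qed

lemma fourier_coeff_eq: "wiener_series \<alpha> c a \<Longrightarrow> fourier_coeff a = c"
  unfolding fourier_coeff_def by (rule the_equality) (auto dest: wiener_series_unique)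

lemma wiener_space_mono: "X \<alpha> \<subseteq> X \<beta> \<Longrightarrow> wiener_space \<alpha> \<subseteq> wiener_space \<beta>"
  unfolding wiener_space_def using wiener_series_mono by blast

end

text \<open>
  A bound in \<open>Y\<^sub>\<beta>\<close> on the powers of some \<open>c \<in> Y\<^sub>\<alpha>\<close> with \<open>h \<alpha> \<le> \<beta>\<close> presupposes
  \<open>c \<in> Y\<^sub>\<beta>\<close>. This does not follow from \<open>h \<alpha> \<le> \<beta>\<close> alone; it does if \<open>\<alpha> \<le> \<beta>\<close>, in
  particular if \<open>1 \<in> X \<beta>\<close>.
\<close>

lemma (in unital_strong_algebra) index_le_if_one_in:
  assumes "X (h \<alpha>) \<subseteq> X \<beta>" and "1 \<in> X \<beta>" shows "X \<alpha> \<subseteq> X \<beta>"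
proof
  fix x assume "x \<in> X \<alpha>"
  from mult_left[OF assms(1) this assms(2)] show "x \<in> X \<beta>" by simp
qed

lemma (in unital_strong_algebra) wiener_space_if_one_in:
  "X (h \<alpha>) \<subseteq> X \<beta> \<Longrightarrow> 1 \<in> X \<beta> \<Longrightarrow> wiener_space \<alpha> \<subseteq> wiener_space \<beta>"
  by (rule wiener_space_mono[OF index_le_if_one_in])


section \<open>Canonical factorization\<close>

definition GL :: "'b::{ring, monoid_mult} set \<Rightarrow> 'b set" where
  "GL U = {a \<in> U. \<exists>b\<in>U. a * b = 1 \<and> b * a = 1}"

definition inverse_in :: "'b::{ring, monoid_mult} set \<Rightarrow> 'b \<Rightarrow> 'b" where
  "inverse_in U a = (THE b. b \<in> U \<and> a * b = 1 \<and> b * a = 1)"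

lemma inverse_in_eq:
  assumes "b \<in> U" "a * b = 1" "b * a = 1"
  shows "inverse_in U a = b"
  unfolding inverse_in_def
proof (rule the_equality)
  fix b' assume "b' \<in> U \<and> a * b' = 1 \<and> b' * a = 1"
  then have "b' = (b * a) * b'" "b * (a * b') = b" using assms by simp_all
  then show "b' = b" by (simp add: mult.assoc)
qed (use assms in auto)

definition has_canonical_factorization ::
    "'b::{ring, monoid_mult} set \<Rightarrow> 'b set \<Rightarrow> 'b set \<Rightarrow> 'b \<Rightarrow> bool" where
  "has_canonical_factorization U P M a \<longleftrightarrow>
     a \<in> GL U \<and>
     (\<exists>a_minus\<in>GL U. \<exists>a_plus\<in>GL U. a = a_minus * a_plus \<and>
        a_plus - 1 \<in> P \<and> inverse_in U a_plus - 1 \<in> P \<and>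
        a_minus - 1 \<in> M \<and> inverse_in U a_minus - 1 \<in> M)"

end

theory Submission
  imports Defs "HOL-Computational_Algebra.Formal_Power_Series"
begin

text \<open>
  Write \<open>a = 1 - c\<close>, and let \<open>P\<close> and \<open>Q\<close> be the projections of a Wiener series onto its negative
  frequencies (the plus part) and its nonnegative ones (the minus part). If \<open>a = m p\<close> is the
  factorization to be found, with \<open>x\<close> inverse to \<open>p\<close> and \<open>y\<close> inverse to \<open>m\<close>, then \<open>a x = m\<close> and \<open>y a = p\<close> force \<open>x = 1 + P(c x)\<close> and
  \<open>y = 1 + Q(y c)\<close>. Multiplication by \<open>c\<close> contracts the norm of \<open>Y\<^sub>\<beta>\<close> by the factor
  \<open>q = A\<^sub>\<beta>\<^sub>,\<^sub>\<alpha> \<parallel>c\<parallel>\<^sub>\<alpha> < 1\<close> and the projections do not increase it, so both equations are solved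
  by geometric series \<open>x = \<Sum> x\<^sub>k\<close>, \<open>y = \<Sum> y\<^sub>k\<close> with \<open>x\<^sub>0 = y\<^sub>0 = 1\<close>,
  \<open>x\<^sub>k\<^sub>+\<^sub>1 = P(c x\<^sub>k)\<close> and \<open>y\<^sub>k\<^sub>+\<^sub>1 = Q(y\<^sub>k c)\<close>.

  It remains to see that \<open>m := a x\<close> and \<open>p := y a\<close> are inverse to \<open>y\<close> and \<open>x\<close> on both sides.
  Since \<open>p x = y a x = y m\<close>, and \<open>p x - 1\<close> has negative frequencies only while \<open>y m - 1\<close> has none,
  \<open>p x = y m = 1\<close>. That \<open>x p = m y = 1\<close> does not follow by ring theory alone, as the algebra is
  not commutative. A homotopy from \<open>a\<close> to \<open>1\<close> would do in a Banach algebra; its algebraic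
  counterpart, which avoids any norm on the union of the spaces, is to replace \<open>c\<close> by \<open>c X\<close> with
  a formal variable \<open>X\<close>. Then \<open>x\<close>, \<open>y\<close>, \<open>p\<close>, \<open>m\<close> become formal power series with constant term
  \<open>1\<close>, the frequency argument applies to each coefficient, and a formal power series with constant
  term \<open>1\<close> is left cancellable, so that one-sided inverses are two-sided
  (\<open>fps_canonical_factorization\<close>).

  The identities of formal series are then transported to \<open>X = 1\<close> (\<open>evaluates_mult\<close>): Cauchy
  products of absolutely convergent series converge, because for every \<open>\<gamma>\<close> there is a \<open>\<delta>\<close> such
  that multiplication is bounded from \<open>X\<^sub>\<gamma> \<times> X\<^sub>\<delta>\<close> to \<open>X\<^sub>\<delta>\<close> and \<open>X\<^sub>\<gamma> \<subseteq> X\<^sub>\<delta>\<close>. This holds for all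
  \<open>\<gamma>\<close>, without smallness, and so only the geometric estimate takes place in \<open>Y\<^sub>\<beta>\<close>.
\<close>

section \<open>Absolutely convergent families\<close>

lemma eventually_finite_subset:
  "\<forall>\<^sub>F F in finite_subsets_at_top I. finite F \<and> F \<subseteq> I"
  by (rule eventually_finite_subsets_at_top_weakI) auto

lemma eventually_infsum_tail_less:
  fixes g :: "'b \<Rightarrow> real"
  assumes g: "g summable_on I" and e: "e > 0"
  shows "\<forall>\<^sub>F F in finite_subsets_at_top I. infsum g (I - F) < e"
proof -
  have "(sum g \<longlongrightarrow> infsum g I) (finite_subsets_at_top I)"
    using has_sum_infsum[OF g] by (simp add: has_sum_def)
  then have "\<forall>\<^sub>F F in finite_subsets_at_top I. dist (sum g F) (infsum g I) < e"
    using e by (rule tendstoD)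
  then show ?thesis
    using eventually_finite_subset[of I]
  proof eventually_elim
    case (elim F)
    then have "infsum g (I - F) = infsum g I - sum g F"
      by (subst infsum_Diff) (use g in auto)
    then show ?case using elim by (simp add: dist_real_def)
  qed
qed

context banach_subspace
begin

text \<open>
  The index set is arbitrary and unordered. Absolute convergence is part of the notion, so that
  sums may be regrouped (\<open>abs_has_sum_Sigma\<close>). Both a Wiener series and the evaluation of a formal
  power series are instances, pointwise in \<open>t\<close>.
\<close>

definition abs_has_sum :: "('b \<Rightarrow> 'a) \<Rightarrow> 'b set \<Rightarrow> 'a \<Rightarrow> bool" where
  "abs_has_sum f I s \<longleftrightarrow> (\<forall>i\<in>I. f i \<in> S) \<and> (\<lambda>i. N (f i)) summable_on I \<and>
     limitin (norm_topology S N) (sum f) s (finite_subsets_at_top I)"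

lemma abs_has_sumD:
  assumes "abs_has_sum f I s"
  shows abs_has_sum_in: "i \<in> I \<Longrightarrow> f i \<in> S"
    and abs_has_sum_summable: "(\<lambda>i. N (f i)) summable_on I"
    and abs_has_sum_limit_in: "s \<in> S"
    and abs_has_sum_eventually:
      "e > 0 \<Longrightarrow> \<forall>\<^sub>F F in finite_subsets_at_top I. N (sum f F - s) < e"
  using assms unfolding abs_has_sum_def limitin_norm_topology by (auto elim: eventually_mono)

lemma norm_sum_le_infsum:
  assumes "\<And>i. i \<in> I \<Longrightarrow> f i \<in> S" "(\<lambda>i. N (f i)) summable_on I" "finite F" "F \<subseteq> I"
  shows "N (sum f F) \<le> (\<Sum>\<^sub>\<infinity>i\<in>I. N (f i))"
proof -
  have "N (sum f F) \<le> (\<Sum>i\<in>F. N (f i))" using assms by (intro N_sum) auto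
  also have "\<dots> \<le> (\<Sum>\<^sub>\<infinity>i\<in>I. N (f i))"
    using assms by (intro finite_sum_le_infsum) (auto intro: N_nonneg)
  finally show ?thesis .
qed

text \<open>
  Beyond \<open>F\<close>, the norm of every finite partial sum is bounded by the tail of the series of norms;
  the bound passes to the limit.
\<close>

lemma abs_has_sum_tail_bound:
  assumes f: "abs_has_sum f I s" and F: "finite F" "F \<subseteq> I"
  shows "N (s - sum f F) \<le> (\<Sum>\<^sub>\<infinity>i\<in>I - F. N (f i))"
proof (rule field_le_epsilon)
  fix e :: real assume e: "e > 0"
  have "\<forall>\<^sub>F G in finite_subsets_at_top I. finite G \<and> F \<subseteq> G \<and> G \<subseteq> I"
    using F by (auto simp: eventually_finite_subsets_at_top)
  then have "\<forall>\<^sub>F G in finite_subsets_at_top I.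
      (finite G \<and> F \<subseteq> G \<and> G \<subseteq> I) \<and> N (sum f G - s) < e"
    using abs_has_sum_eventually[OF f e] by (rule eventually_conj)
  from eventually_happens'[OF finite_subsets_at_top_neq_bot this]
      obtain G where G: "finite G" "F \<subseteq> G" "G \<subseteq> I" "N (sum f G - s) < e"
    by blast
  have fS: "\<And>i. i \<in> I \<Longrightarrow> f i \<in> S" and s: "s \<in> S"
    using abs_has_sumD[OF f] by auto
  have GS: "sum f G \<in> S" "sum f (G - F) \<in> S" using fS G by (auto intro!: sum_S)
  have "N (sum f (G - F)) \<le> (\<Sum>\<^sub>\<infinity>i\<in>I - F. N (f i))"
    using fS G abs_has_sum_summable[OF f]
    by (intro norm_sum_le_infsum) (auto intro: summable_on_subset)
  have eq: "s - sum f F = sum f (G - F) - (sum f G - s)"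
    using G by (simp add: sum_diff algebra_simps)
  have "N (s - sum f F) \<le> N (sum f (G - F)) + N (sum f G - s)"
    unfolding eq using GS s by (intro N_diff_triangle diff_S)
  then show "N (s - sum f F) \<le> (\<Sum>\<^sub>\<infinity>i\<in>I - F. N (f i)) + e"
    using G(4) \<open>N (sum f (G - F)) \<le> _\<close> by linarith
qed

lemma abs_has_sum_norm_le: "abs_has_sum f I s \<Longrightarrow> N s \<le> (\<Sum>\<^sub>\<infinity>i\<in>I. N (f i))"
  using abs_has_sum_tail_bound[of f I s "{}"] by simp

lemma abs_has_sum_unique:
  assumes f: "abs_has_sum f I s" "abs_has_sum f I s'"
  shows "s = s'"
proof -
  have s: "s \<in> S" "s' \<in> S" using f abs_has_sum_limit_in by auto
  have "N (s - s') \<le> 0 + e" if e: "e > 0" for e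
  proof -
    have "e / 2 > 0" using e by simp
    then have "\<forall>\<^sub>F F in finite_subsets_at_top I. N (sum f F - s) < e / 2 \<and> N (sum f F - s') < e / 2
        \<and> (finite F \<and> F \<subseteq> I)"
      by (intro eventually_conj abs_has_sum_eventually[OF f(1)] abs_has_sum_eventually[OF f(2)]
            eventually_finite_subset)
    from eventually_happens'[OF finite_subsets_at_top_neq_bot this]
      obtain F where F: "N (sum f F - s) < e / 2" "N (sum f F - s') < e / 2" "F \<subseteq> I"
      by blast
    have "sum f F \<in> S" using F abs_has_sum_in[OF f(1)] by (auto intro!: sum_S)
    then show ?thesis
      using N_diff_triangle[of "sum f F - s'" "sum f F - s"] F s diff_S by force
  qed
  then have "N (s - s') \<le> 0" by (rule field_le_epsilon)
  then show ?thesis using N_nonneg[of "s - s'"] N_eq_0[of "s - s'"] s diff_S by force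
qed

text \<open>
  Completeness is a statement about sequences, so finite sets \<open>F n\<close> are chosen whose tails tend to
  zero. The partial sums over them form a Cauchy sequence, and its limit is also that of the net of
  all finite partial sums, since two partial sums differ by at most the sum of their tails.
\<close>

lemma abs_has_sum_exists:
  assumes fS: "\<And>i. i \<in> I \<Longrightarrow> f i \<in> S" and sm: "(\<lambda>i. N (f i)) summable_on I"
  shows "\<exists>s. abs_has_sum f I s"
proof -
  interpret m: Metric_space S "norm_dist S N" by (rule metric)
  define tail where "tail F = (\<Sum>\<^sub>\<infinity>i\<in>I - F. N (f i))" for F
  have "\<exists>F. finite F \<and> F \<subseteq> I \<and> tail F < inverse (real (Suc n))" for n
  proof -
    have "\<forall>\<^sub>F F in finite_subsets_at_top I. (finite F \<and> F \<subseteq> I) \<and> tail F < inverse (real (Suc n))"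
      unfolding tail_def
      by (intro eventually_conj eventually_infsum_tail_less sm eventually_finite_subset) auto
    from eventually_happens'[OF finite_subsets_at_top_neq_bot this] show ?thesis by blast
  qed
  then obtain F where F: "\<And>n. finite (F n)" "\<And>n. F n \<subseteq> I"
      "\<And>n. tail (F n) < inverse (real (Suc n))" by metis
  have sumS: "sum f G \<in> S" if "G \<subseteq> I" for G using that fS by (auto intro!: sum_S)
  have half: "N (sum f (G - H)) \<le> tail H" if "finite G" "G \<subseteq> I" for G H
    unfolding tail_def using that fS sm
    by (intro norm_sum_le_infsum) (auto intro: summable_on_subset)
  \<comment> \<open>Only the two set differences contribute, and each is disjoint from the other set.\<close>
  have near: "N (sum f G - sum f H) \<le> tail G + tail H"
    if "finite G" "G \<subseteq> I" "finite H" "H \<subseteq> I" for G H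
  proof -
    have "sum f G - sum f H = sum f (G - H) - sum f (H - G)"
      using that sum.Int_Diff[of G f H] sum.Int_Diff[of H f G]
      by (simp add: Int_commute algebra_simps)
    then show ?thesis
      using N_diff_triangle[OF sumS sumS, of "G - H" "H - G"] half[of G H] half[of H G] that
      by force
  qed
  have inv: "\<exists>M. \<forall>n\<ge>M. inverse (real (Suc n)) < e" if pos: "e > 0" for e
  proof -
    obtain M where M: "inverse (real (Suc M)) < e" using reals_Archimedean[OF pos] by blast
    have "inverse (real (Suc n)) < e" if "M \<le> n" for n
      using that M le_imp_inverse_le[of "real (Suc M)" "real (Suc n)"] by linarith
    then show ?thesis by blast
  qed
  have "m.MCauchy (\<lambda>n. sum f (F n))"
    unfolding m.MCauchy_def
  proof (intro conjI allI impI)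
    show "range (\<lambda>n. sum f (F n)) \<subseteq> S" using sumS F by auto
    fix e :: real assume "e > 0"
    then obtain M where M: "\<forall>n\<ge>M. inverse (real (Suc n)) < e / 2" using inv[of "e/2"] by auto
    have "norm_dist S N (sum f (F n)) (sum f (F n')) < e" if "M \<le> n" "M \<le> n'" for n n'
    proof -
      have "tail (F n) < e / 2" "tail (F n') < e / 2"
        using that M F(3) by (meson order_less_trans)+
      then show ?thesis using near[OF F(1,2) F(1,2), of n n'] sumS F by (simp add: norm_dist_def)
    qed
    then show "\<exists>M. \<forall>n n'. M \<le> n \<longrightarrow> M \<le> n' \<longrightarrow> norm_dist S N (sum f (F n)) (sum f (F n')) < e"
      by blast
  qed
  then obtain s where "limitin m.mtopology (\<lambda>n. sum f (F n)) s sequentially"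
    using complete unfolding m.mcomplete_def by blast
  then have s: "s \<in> S" and lim: "\<And>e. e > 0 \<Longrightarrow> \<forall>\<^sub>F n in sequentially. N (sum f (F n) - s) < e"
    using limitin_norm_topology[of "\<lambda>n. sum f (F n)" s sequentially]
    by (auto simp: norm_topology_def elim: eventually_mono)
  have "abs_has_sum f I s"
    unfolding abs_has_sum_def limitin_norm_topology
  proof (intro conjI ballI allI impI)
    fix e :: real assume e: "e > 0"
    obtain M where M: "\<forall>n\<ge>M. inverse (real (Suc n)) < e / 3" using inv[of "e/3"] e by auto
    have "e / 3 > 0" using e by simp
    from lim[OF this] obtain M' where M': "\<And>n. n \<ge> M' \<Longrightarrow> N (sum f (F n) - s) < e / 3"
      unfolding eventually_sequentially by auto
    define n where "n = max M M'"
    have n: "N (sum f (F n) - s) < e / 3" "tail (F n) < e / 3"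
      using M'[of n] M[rule_format, of n] F(3)[of n] by (auto simp: n_def)
    have "\<forall>\<^sub>F G in finite_subsets_at_top I. (finite G \<and> G \<subseteq> I) \<and> tail G < e / 3"
      unfolding tail_def using e
      by (intro eventually_conj eventually_infsum_tail_less sm eventually_finite_subset) auto
    then show "\<forall>\<^sub>F G in finite_subsets_at_top I. sum f G \<in> S \<and> N (sum f G - s) < e"
    proof eventually_elim
      case (elim G)
      have "sum f G - s = (sum f G - sum f (F n)) + (sum f (F n) - s)" by simp
      moreover have "N ((sum f G - sum f (F n)) + (sum f (F n) - s))
          \<le> N (sum f G - sum f (F n)) + N (sum f (F n) - s)"
        using elim F sumS s by (intro N_triangle diff_S) auto
      ultimately show ?case using near[of G "F n"] elim F n sumS by force
    qed
  qed (use s fS sm in auto)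
  then show ?thesis ..
qed

text \<open>
  To identify the sum of an absolutely convergent family, it is enough to approximate the candidate
  along some finite sets with small tails, instead of along all large finite sets.
\<close>

lemma abs_has_sumI_approx:
  assumes fS: "\<And>i. i \<in> I \<Longrightarrow> f i \<in> S" and sm: "(\<lambda>i. N (f i)) summable_on I" and s: "s \<in> S"
    and approx: "\<And>e. e > 0 \<Longrightarrow> \<exists>F. finite F \<and> F \<subseteq> I \<and>
          (\<Sum>\<^sub>\<infinity>i\<in>I - F. N (f i)) \<le> e \<and> N (s - sum f F) \<le> e"
  shows "abs_has_sum f I s"
proof -
  obtain r where r: "abs_has_sum f I r" using abs_has_sum_exists[OF fS sm] by blast
  have rS: "r \<in> S" using r by (rule abs_has_sum_limit_in)
  have "N (s - r) \<le> 0 + e" if "e > 0" for e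
  proof -
    obtain F where F: "finite F" "F \<subseteq> I" "(\<Sum>\<^sub>\<infinity>i\<in>I - F. N (f i)) \<le> e / 2" "N (s - sum f F) \<le> e / 2"
      using approx[of "e / 2"] \<open>e > 0\<close> by auto
    have "sum f F \<in> S" using F fS by (auto intro!: sum_S)
    then show ?thesis
      using N_diff_triangle[of "s - sum f F" "r - sum f F"] s rS diff_S F
        abs_has_sum_tail_bound[OF r F(1,2)] by force
  qed
  then have "N (s - r) \<le> 0" by (rule field_le_epsilon)
  then have "s = r" using N_nonneg[of "s - r"] N_eq_0[of "s - r"] s rS diff_S by force
  then show ?thesis using r by simp
qed

lemma abs_has_sum_diff:
  assumes f: "abs_has_sum f I s" and g: "abs_has_sum g I r"
  shows "abs_has_sum (\<lambda>i. f i - g i) I (s - r)"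
  unfolding abs_has_sum_def limitin_norm_topology
proof (intro conjI ballI allI impI)
  note D = abs_has_sumD[OF f] abs_has_sumD[OF g]
  show fg: "f i - g i \<in> S" if "i \<in> I" for i using that D by (auto intro: diff_S)
  show "s - r \<in> S" using D by (auto intro: diff_S)
  show "(\<lambda>i. N (f i - g i)) summable_on I"
  proof (rule summable_on_comparison_test)
    show "(\<lambda>i. N (f i) + N (g i)) summable_on I" using D by (intro summable_on_add) auto
  qed (use D fg in \<open>auto intro: N_diff_triangle N_nonneg\<close>)
  fix e :: real assume "e > 0"
  then have "\<forall>\<^sub>F F in finite_subsets_at_top I.
      N (sum f F - s) < e/2 \<and> N (sum g F - r) < e/2 \<and> (finite F \<and> F \<subseteq> I)"
    using D by (intro eventually_conj D eventually_finite_subset) auto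
  then show "\<forall>\<^sub>F F in finite_subsets_at_top I.
      (\<Sum>i\<in>F. f i - g i) \<in> S \<and> N ((\<Sum>i\<in>F. f i - g i) - (s - r)) < e"
  proof eventually_elim
    case (elim F)
    have "sum f F \<in> S" "sum g F \<in> S" using D elim by (auto intro!: sum_S)
    have eq: "(\<Sum>i\<in>F. f i - g i) - (s - r) = (sum f F - s) - (sum g F - r)"
      by (simp add: sum_subtractf)
    have "N ((\<Sum>i\<in>F. f i - g i) - (s - r)) \<le> N (sum f F - s) + N (sum g F - r)"
      unfolding eq by (intro N_diff_triangle diff_S D \<open>sum f F \<in> S\<close> \<open>sum g F \<in> S\<close>)
    then have "N ((\<Sum>i\<in>F. f i - g i) - (s - r)) < e" using elim by linarith
    then show ?case
      using diff_S[OF \<open>sum f F \<in> S\<close> \<open>sum g F \<in> S\<close>] by (simp add: sum_subtractf)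
  qed
qed

lemma abs_has_sum_finite_support:
  assumes F: "finite F" "F \<subseteq> I" and fS: "\<And>i. i \<in> F \<Longrightarrow> f i \<in> S" and z: "\<And>i. i \<in> I - F \<Longrightarrow> f i = 0"
  shows "abs_has_sum f I (sum f F)"
proof (rule abs_has_sumI_approx)
  have N0: "N 0 = 0" using N_eq_0[OF zero_S] by simp
  show "f i \<in> S" if "i \<in> I" for i using fS z that zero_S by (cases "i \<in> F") auto
  have "(\<lambda>i. N (f i)) summable_on F" using F by simp
  then show "(\<lambda>i. N (f i)) summable_on I"
    by (subst summable_on_cong_neutral[where T = F and g = "\<lambda>i. N (f i)"]) (use F z N0 in auto)
  show "sum f F \<in> S" using fS by (rule sum_S)
  fix e :: real assume "e > 0"
  moreover have "(\<Sum>\<^sub>\<infinity>i\<in>I - F. N (f i)) = 0" using z N0 by (intro infsum_0) auto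
  ultimately show "\<exists>F'. finite F' \<and> F' \<subseteq> I \<and> (\<Sum>\<^sub>\<infinity>i\<in>I - F'. N (f i)) \<le> e \<and> N (sum f F - sum f F') \<le> e"
    using F N0 by (intro exI[of _ F]) auto
qed

lemma abs_has_sum_reindex:
  assumes inj: "inj_on k J"
  shows "abs_has_sum f (k ` J) s \<longleftrightarrow> abs_has_sum (\<lambda>j. f (k j)) J s"
proof -
  have "limitin (norm_topology S N) (sum f) s (finite_subsets_at_top (k ` J)) \<longleftrightarrow>
        limitin (norm_topology S N) (\<lambda>G. sum f (k ` G)) s (finite_subsets_at_top J)"
    unfolding limitin_def
    by (simp add: filtermap_image_finite_subsets_at_top[OF inj, symmetric] eventually_filtermap)
  also have "\<dots> \<longleftrightarrow> limitin (norm_topology S N) (sum (\<lambda>j. f (k j))) s (finite_subsets_at_top J)"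
  proof -
    have "\<forall>\<^sub>F G in finite_subsets_at_top J. sum f (k ` G) = sum (\<lambda>j. f (k j)) G"
      using inj by (intro eventually_finite_subsets_at_top_weakI)
        (simp add: sum.reindex inj_on_subset)
    then have "(\<forall>\<^sub>F G in finite_subsets_at_top J. sum f (k ` G) \<in> V) \<longleftrightarrow>
          (\<forall>\<^sub>F G in finite_subsets_at_top J. sum (\<lambda>j. f (k j)) G \<in> V)" for V
      by (rule eventually_cong) simp
    then show ?thesis unfolding limitin_def by simp
  qed
  finally show ?thesis
    unfolding abs_has_sum_def by (simp add: summable_on_reindex[OF inj] o_def)
qed

text \<open>
  Fubini for unconditional sums. Take a finite set \<open>H\<close> of pairs outside of which the norms add up to
  little, and a finite \<open>F\<close> containing the first components of \<open>H\<close>: the rows in \<open>F\<close> differ from their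
  parts in \<open>H\<close> by tails which together are part of the tail outside \<open>H\<close>.
\<close>

lemma abs_has_sum_Sigma:
  assumes f: "abs_has_sum f (Sigma I B) s"
    and g: "\<And>i. i \<in> I \<Longrightarrow> abs_has_sum (\<lambda>j. f (i, j)) (B i) (g i)"
  shows "abs_has_sum g I s"
    and "(\<Sum>\<^sub>\<infinity>i\<in>I. N (g i)) \<le> (\<Sum>\<^sub>\<infinity>p\<in>Sigma I B. N (f p))"
proof -
  define nf where "nf = (\<lambda>p. N (f p))"
  note D = abs_has_sumD[OF f] and G = abs_has_sumD[OF g]
  have nf: "nf summable_on Sigma I B" using D unfolding nf_def by simp
  have nf0: "0 \<le> nf p" if "p \<in> Sigma I B" for p unfolding nf_def using D that by (intro N_nonneg)
  have inner: "(\<lambda>i. \<Sum>\<^sub>\<infinity>j\<in>B i. nf (i, j)) summable_on I"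
    using nf by (intro summable_on_Sigma_banach) (simp add: case_prod_unfold)
  have le: "N (g i) \<le> (\<Sum>\<^sub>\<infinity>j\<in>B i. nf (i, j))" if "i \<in> I" for i
    using abs_has_sum_norm_le[OF g[OF that]] by (simp add: nf_def)
  have sg: "(\<lambda>i. N (g i)) summable_on I"
    by (rule summable_on_comparison_test[OF inner]) (use le G in \<open>auto intro: N_nonneg\<close>)
  show "(\<Sum>\<^sub>\<infinity>i\<in>I. N (g i)) \<le> (\<Sum>\<^sub>\<infinity>p\<in>Sigma I B. N (f p))"
    using infsum_mono[OF sg inner le] infsum_Sigma_banach[OF nf] by (simp add: nf_def)
  show "abs_has_sum g I s"
  proof (rule abs_has_sumI_approx)
    fix e :: real assume e: "e > 0"
    have "\<forall>\<^sub>F H in finite_subsets_at_top (Sigma I B).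
        (finite H \<and> H \<subseteq> Sigma I B) \<and> infsum nf (Sigma I B - H) < e / 2"
      using e nf by (intro eventually_conj eventually_infsum_tail_less eventually_finite_subset) auto
    from eventually_happens'[OF finite_subsets_at_top_neq_bot this]
      obtain H where H: "finite H" "H \<subseteq> Sigma I B" "infsum nf (Sigma I B - H) < e / 2"
      by blast
    have "\<forall>\<^sub>F F in finite_subsets_at_top I. (finite F \<and> fst ` H \<subseteq> F \<and> F \<subseteq> I)
        \<and> (\<Sum>\<^sub>\<infinity>i\<in>I - F. N (g i)) < e"
      using H by (intro eventually_conj eventually_infsum_tail_less sg e)
        (auto simp: eventually_finite_subsets_at_top intro!: exI[of _ "fst ` H"])
    from eventually_happens'[OF finite_subsets_at_top_neq_bot this]
      obtain F where F: "finite F" "fst ` H \<subseteq> F" "F \<subseteq> I" "(\<Sum>\<^sub>\<infinity>i\<in>I - F. N (g i)) < e"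
      by blast
    define Hi where "Hi i = {j. (i, j) \<in> H}" for i
    have Hi: "finite (Hi i)" "i \<in> I \<Longrightarrow> Hi i \<subseteq> B i" for i
    proof -
      have "Hi i \<subseteq> snd ` H" by (force simp: Hi_def)
      then show "finite (Hi i)" using H(1) finite_surj by blast
    qed (use H in \<open>auto simp: Hi_def\<close>)
    have H_eq: "H = Sigma F Hi" using F by (force simp: Hi_def)
    have sumH: "sum f H = (\<Sum>i\<in>F. \<Sum>j\<in>Hi i. f (i, j))"
      unfolding H_eq using F Hi by (subst sum.Sigma) auto
    have fS: "f p \<in> S" if "p \<in> Sigma I B" for p using D that by auto
    have inS: "(\<Sum>j\<in>Hi i. f (i, j)) \<in> S" "g i \<in> S" if "i \<in> F" for i
      using that F Hi(2)[of i] G by (auto intro!: sum_S fS)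
    have sub: "Sigma F (\<lambda>i. B i - Hi i) \<subseteq> Sigma I B - H" using F by (auto simp: Hi_def)
    have nfF: "nf summable_on Sigma F (\<lambda>i. B i - Hi i)" "nf summable_on Sigma I B - H"
      using nf by (rule summable_on_subset; use sub in blast)+
    have "N (sum g F - sum f H) = N (\<Sum>i\<in>F. g i - (\<Sum>j\<in>Hi i. f (i, j)))"
      by (simp add: sumH sum_subtractf)
    also have "\<dots> \<le> (\<Sum>i\<in>F. N (g i - (\<Sum>j\<in>Hi i. f (i, j))))"
      using inS by (intro N_sum diff_S)
    also have "\<dots> \<le> (\<Sum>i\<in>F. \<Sum>\<^sub>\<infinity>j\<in>B i - Hi i. nf (i, j))"
      unfolding nf_def using F(3) by (intro sum_mono abs_has_sum_tail_bound g Hi) blast+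
    also have "\<dots> = infsum nf (Sigma F (\<lambda>i. B i - Hi i))"
      using infsum_Sigma_banach[OF nfF(1)] F by simp
    also have "\<dots> \<le> infsum nf (Sigma I B - H)"
      using nfF sub nf0 by (intro infsum_mono2) auto
    finally have 1: "N (sum g F - sum f H) < e / 2" using H by simp
    have 2: "N (s - sum f H) < e / 2"
      using abs_has_sum_tail_bound[OF f H(1,2)] H(3) by (simp add: nf_def)
    have "sum f H \<in> S" "sum g F \<in> S" using H inS by (auto intro!: sum_S fS)
    then have "N (s - sum g F) \<le> e"
      using N_diff_triangle[of "s - sum f H" "sum g F - sum f H"] 1 2 D diff_S by force
    then show "\<exists>F. finite F \<and> F \<subseteq> I \<and> (\<Sum>\<^sub>\<infinity>i\<in>I - F. N (g i)) \<le> e \<and> N (s - sum g F) \<le> e"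
      using F by (intro exI[of _ F]) auto
  qed (use D G sg in auto)
qed

lemma abs_has_sum_bounded_additive:
  assumes S': "banach_subspace scale S' N'" and f: "abs_has_sum f I s"
    and add: "\<And>x y. L (x + y) = L x + L y"
    and LS: "\<And>x. x \<in> S \<Longrightarrow> L x \<in> S'" and bd: "\<And>x. x \<in> S \<Longrightarrow> N' (L x) \<le> C * N x"
  shows "banach_subspace.abs_has_sum S' N' (\<lambda>i. L (f i)) I (L s)"
proof -
  interpret b: banach_subspace scale S' N' by (rule S')
  interpret L: additive L by standard (rule add)
  note D = abs_has_sumD[OF f]
  have C: "C * N x \<le> (\<bar>C\<bar> + 1) * N x" if "x \<in> S" for x
    using that N_nonneg by (intro mult_right_mono) auto
  show ?thesis
    unfolding b.abs_has_sum_def b.limitin_norm_topology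
  proof (intro conjI ballI allI impI)
    show "(\<lambda>i. N' (L (f i))) summable_on I"
      by (rule summable_on_comparison_test[where f = "\<lambda>i. C * N (f i)"])
        (use D LS bd b.N_nonneg in \<open>auto intro: summable_on_cmult_right\<close>)
    fix e :: real assume e: "e > 0"
    then have "e / (\<bar>C\<bar> + 1) > 0" by simp
    then have "\<forall>\<^sub>F F in finite_subsets_at_top I. N (sum f F - s) < e / (\<bar>C\<bar> + 1) \<and> (finite F \<and> F \<subseteq> I)"
      using D by (intro eventually_conj D eventually_finite_subset) auto
    then show "\<forall>\<^sub>F F in finite_subsets_at_top I.
        (\<Sum>i\<in>F. L (f i)) \<in> S' \<and> N' ((\<Sum>i\<in>F. L (f i)) - L s) < e"
    proof eventually_elim
      case (elim F)
      have "sum f F \<in> S" using D elim by (auto intro!: sum_S)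
      then have d: "sum f F - s \<in> S" using D diff_S by auto
      have "N' (L (sum f F - s)) \<le> (\<bar>C\<bar> + 1) * N (sum f F - s)" using bd[OF d] C[OF d] by simp
      also have "\<dots> < e" using elim by (simp add: pos_less_divide_eq mult.commute)
      finally show ?case using LS[OF \<open>sum f F \<in> S\<close>] by (simp add: L.sum L.diff)
    qed
  qed (use D LS in auto)
qed

end

section \<open>Formal canonical factorization\<close>

text \<open>
  The ring laws for the unit are proved here because \<open>1 \<noteq> 0\<close> is not assumed, so that the
  coefficients need not form a \<^class>\<open>ring_1\<close>.
\<close>

lemma fps_mult_one:
  fixes f :: "'r::{ring, monoid_mult} fps"
  shows "f * 1 = f" and "1 * f = f"
proof -
  have "fps_nth (f * 1) n = fps_nth f n" for n
  proof -
    have "fps_nth (f * 1) n = (\<Sum>i=0..n. if i = n then fps_nth f i else 0)"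
      unfolding fps_mult_nth by (intro sum.cong) auto
    then show ?thesis by simp
  qed
  then show "f * 1 = f" by (simp add: fps_eq_iff)
  have "fps_nth (1 * f) n = fps_nth f n" for n
  proof -
    have "fps_nth (1 * f) n = (\<Sum>i=0..n. if i = 0 then fps_nth f n else 0)"
      unfolding fps_mult_nth by (intro sum.cong) auto
    then show ?thesis by simp
  qed
  then show "1 * f = f" by (simp add: fps_eq_iff)
qed

text \<open>
  Since \<open>p\<close> has constant term \<open>1\<close>, the \<open>n\<close>-th coefficient of \<open>p * e\<close> is the \<open>n\<close>-th coefficient of
  \<open>e\<close> plus terms with earlier coefficients of \<open>e\<close>.
\<close>

lemma fps_left_cancel_zero:
  fixes p e :: "'r::{ring, monoid_mult} fps"
  assumes pe: "p * e = 0" and p: "fps_nth p 0 = 1"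
  shows "e = 0"
proof -
  have "fps_nth e n = 0" for n
  proof (induction n rule: less_induct)
    case (less n)
    have "0 = (\<Sum>i=0..n. fps_nth p i * fps_nth e (n - i))"
      using pe by (simp add: fps_mult_nth[symmetric])
    also have "\<dots> = (\<Sum>i=0..n. if i = 0 then fps_nth e n else 0)"
      using less p by (intro sum.cong) auto
    finally show ?case by simp
  qed
  then show ?thesis by (simp add: fps_eq_iff)
qed

text \<open>
  \<open>p * (1 - x * p) = p - (p * x) * p = 0\<close>, and \<open>p\<close> can be cancelled.
\<close>

lemma fps_right_inverse_if_left:
  fixes p x :: "'r::{ring, monoid_mult} fps"
  assumes px: "p * x = 1" and p: "fps_nth p 0 = 1"
  shows "x * p = 1"
proof -
  have "p * (1 - x * p) = p - (p * x) * p"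
    by (simp add: right_diff_distrib fps_mult_one mult.assoc)
  also have "\<dots> = 0" by (simp add: px fps_mult_one)
  finally show ?thesis using fps_left_cancel_zero[OF _ p] by fastforce
qed

lemma fps_mult_nth_in:
  fixes f g :: "'r::{ring, monoid_mult} fps"
  assumes zero: "0 \<in> P" and add: "\<And>u v. u \<in> P \<Longrightarrow> v \<in> P \<Longrightarrow> u + v \<in> P"
    and mult: "\<And>u v. u \<in> P \<Longrightarrow> v \<in> P \<Longrightarrow> u * v \<in> P"
    and f: "fps_nth f 0 = 1" "\<And>k. k > 0 \<Longrightarrow> fps_nth f k \<in> P"
    and g: "fps_nth g 0 = 1" "\<And>k. k > 0 \<Longrightarrow> fps_nth g k \<in> P"
    and n: "n > 0"
  shows "fps_nth (f * g) n \<in> P"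
proof -
  have sum_in: "sum u F \<in> P" if "finite F" "\<And>i. i \<in> F \<Longrightarrow> u i \<in> P" for u :: "nat \<Rightarrow> 'r" and F
    using that by (induction F rule: finite_induct) (auto intro: zero add)
  have "fps_nth f i * fps_nth g (n - i) \<in> P" if "i \<le> n" for i
    using that f g n mult[of "fps_nth f i" "fps_nth g (n - i)"]
    by (cases "i = 0"; cases "i = n") auto
  then show ?thesis unfolding fps_mult_nth by (intro sum_in) auto
qed

text \<open>
  Here \<open>y * a\<close> and \<open>a * x\<close> are the factors, with inverses \<open>x\<close> and \<open>y\<close>. The series
  \<open>(y * a) * x = y * (a * x)\<close> has its higher coefficients in \<open>P\<close> by the first bracketing and in \<open>M\<close>
  by the second, so they vanish.
\<close>

lemma fps_canonical_factorization:
  fixes a x y :: "'r::{ring, monoid_mult} fps"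
  assumes P: "0 \<in> P" "\<And>u v. u \<in> P \<Longrightarrow> v \<in> P \<Longrightarrow> u + v \<in> P"
      "\<And>u v. u \<in> P \<Longrightarrow> v \<in> P \<Longrightarrow> u * v \<in> P"
    and M: "0 \<in> M" "\<And>u v. u \<in> M \<Longrightarrow> v \<in> M \<Longrightarrow> u + v \<in> M"
      "\<And>u v. u \<in> M \<Longrightarrow> v \<in> M \<Longrightarrow> u * v \<in> M"
    and PM: "P \<inter> M \<subseteq> {0}"
    and zero: "fps_nth a 0 = 1" "fps_nth x 0 = 1" "fps_nth y 0 = 1"
    and x: "\<And>k. k > 0 \<Longrightarrow> fps_nth x k \<in> P" and ya: "\<And>k. k > 0 \<Longrightarrow> fps_nth (y * a) k \<in> P"
    and y: "\<And>k. k > 0 \<Longrightarrow> fps_nth y k \<in> M" and ax: "\<And>k. k > 0 \<Longrightarrow> fps_nth (a * x) k \<in> M"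
  shows "(y * a) * x = 1" and "x * (y * a) = 1" and "y * (a * x) = 1" and "(a * x) * y = 1"
proof -
  have "fps_nth ((y * a) * x) k = fps_nth 1 k" for k
  proof (cases "k = 0")
    case False
    have "fps_nth ((y * a) * x) k \<in> P"
      by (rule fps_mult_nth_in[OF P _ ya _ x]) (use False zero in auto)
    moreover have "fps_nth (y * (a * x)) k \<in> M"
      by (rule fps_mult_nth_in[OF M _ y _ ax]) (use False zero in auto)
    ultimately show ?thesis using False PM by (auto simp: mult.assoc)
  qed (simp add: zero)
  then show 1: "(y * a) * x = 1" by (simp add: fps_eq_iff)
  then show 2: "y * (a * x) = 1" by (simp add: mult.assoc)
  show "x * (y * a) = 1" by (rule fps_right_inverse_if_left[OF 1]) (simp add: zero)
  show "(a * x) * y = 1" by (rule fps_right_inverse_if_left[OF 2]) (simp add: zero)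
qed

section \<open>Wiener series\<close>

context banach_inductive_limit
begin

sublocale space: banach_subspace scale "X \<gamma>" "nrm \<gamma>" for \<gamma>
  by (rule banach)

lemma abs_has_sum_mono:
  assumes sub: "X \<beta> \<subseteq> X \<gamma>" and f: "space.abs_has_sum \<beta> f I s"
  shows "space.abs_has_sum \<gamma> f I s"
proof -
  obtain C where "C > 0" "\<And>x. x \<in> X \<beta> \<Longrightarrow> nrm \<gamma> x \<le> C * nrm \<beta> x"
    using inclusion_bounded[OF sub] by blast
  then show ?thesis
    using space.abs_has_sum_bounded_additive[OF banach f, of "\<lambda>x. x" \<gamma> C] sub by auto
qed

lemma abs_has_sum_unique_index:
  assumes "space.abs_has_sum \<alpha> f I s" "space.abs_has_sum \<beta> f I s'"
  shows "s = s'"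
proof -
  obtain \<gamma> where sub: "X \<alpha> \<subseteq> X \<gamma>" "X \<beta> \<subseteq> X \<gamma>" using directed by blast
  show ?thesis
    by (rule space.abs_has_sum_unique[OF abs_has_sum_mono[OF sub(1) assms(1)]
          abs_has_sum_mono[OF sub(2) assms(2)]])
qed

abbreviation character :: "int \<Rightarrow> real \<Rightarrow> complex" where
  "character n t \<equiv> exp (\<i> * of_int n * of_real t)"

lemma norm_character_scale: "x \<in> X \<gamma> \<Longrightarrow> nrm \<gamma> (scale (character n t) x) = nrm \<gamma> x"
  by (simp add: space.N_scale)

lemma wiener_seriesD:
  assumes "wiener_series \<gamma> c a"
  shows "c n \<in> X \<gamma>" and "(\<lambda>n. nrm \<gamma> (c n)) summable_on UNIV"
    and "space.abs_has_sum \<gamma> (\<lambda>n. scale (character n t) (c n)) UNIV (a t)"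
proof -
  show c: "c n \<in> X \<gamma>" and sm: "(\<lambda>n. nrm \<gamma> (c n)) summable_on UNIV" for n
    using assms unfolding wiener_series_def by auto
  show "space.abs_has_sum \<gamma> (\<lambda>n. scale (character n t) (c n)) UNIV (a t)"
    using assms c sm unfolding space.abs_has_sum_def wiener_series_def
    by (simp add: norm_character_scale space.scale_S)
qed

lemma wiener_seriesI:
  assumes "\<And>n. c n \<in> X \<gamma>" and "(\<lambda>n. nrm \<gamma> (c n)) summable_on UNIV"
    and "\<And>t. space.abs_has_sum \<gamma> (\<lambda>n. scale (character n t) (c n)) UNIV (a t)"
  shows "wiener_series \<gamma> c a"
  using assms unfolding wiener_series_def space.abs_has_sum_def by blast

lemma wiener_series_exists:
  assumes c: "\<And>n. c n \<in> X \<gamma>" and sm: "(\<lambda>n. nrm \<gamma> (c n)) summable_on UNIV"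
  obtains a where "wiener_series \<gamma> c a"
proof -
  have "\<exists>s. space.abs_has_sum \<gamma> (\<lambda>n. scale (character n t) (c n)) UNIV s" for t
    using c sm
    by (intro space.abs_has_sum_exists) (auto simp: norm_character_scale space.scale_S)
  then obtain a where "\<And>t. space.abs_has_sum \<gamma> (\<lambda>n. scale (character n t) (c n)) UNIV (a t)"
    by metis
  then show thesis using that wiener_seriesI[OF c sm] by blast
qed

lemma wiener_series_same_coeffs:
  assumes "wiener_series \<alpha> c a" "wiener_series \<beta> c b" shows "a = b"
  using abs_has_sum_unique_index wiener_seriesD(3)[OF assms(1)] wiener_seriesD(3)[OF assms(2)]
  by blast

lemma wiener_series_diff:
  assumes "wiener_series \<gamma> c a" "wiener_series \<gamma> d b"
  shows "wiener_series \<gamma> (\<lambda>n. c n - d n) (a - b)"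
proof (rule wiener_seriesI)
  note C = wiener_seriesD[OF assms(1)] and D = wiener_seriesD[OF assms(2)]
  show "c n - d n \<in> X \<gamma>" for n using C D by (intro space.diff_S)
  show sum: "space.abs_has_sum \<gamma> (\<lambda>n. scale (character n t) (c n - d n)) UNIV ((a - b) t)" for t
    using space.abs_has_sum_diff[OF C(3) D(3), of t t] by (simp add: scale_right_diff_distrib)
  show "(\<lambda>n. nrm \<gamma> (c n - d n)) summable_on UNIV"
    using space.abs_has_sum_summable[OF sum[of 0]] by simp
qed

lemma wiener_series_single:
  assumes x: "x \<in> X \<gamma>"
  shows "wiener_series \<gamma> (\<lambda>n. if n = 0 then x else 0) (\<lambda>t. x)"
proof (rule wiener_seriesI)
  show "(if n = 0 then x else 0) \<in> X \<gamma>" for n :: int using x space.zero_S by auto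
  show sum: "space.abs_has_sum \<gamma> (\<lambda>n. scale (character n t) (if n = 0 then x else 0)) UNIV x" for t
    using space.abs_has_sum_finite_support
        [of "{0}" UNIV "\<lambda>n. scale (character n t) (if n = 0 then x else 0)" \<gamma>] x
    by simp
  show "(\<lambda>n::int. nrm \<gamma> (if n = 0 then x else 0)) summable_on UNIV"
    using space.abs_has_sum_summable[OF sum[of 0]] by simp
qed

lemma wiener_space_series:
  assumes "a \<in> wiener_space \<gamma>" shows "wiener_series \<gamma> (fourier_coeff a) a"
  using assms fourier_coeff_eq unfolding wiener_space_def by auto

lemma wiener_spaceI: "wiener_series \<gamma> c a \<Longrightarrow> a \<in> wiener_space \<gamma>"
  unfolding wiener_space_def by blast

lemma wiener_norm_eq: "wiener_series \<gamma> c a \<Longrightarrow> wiener_norm \<gamma> a = (\<Sum>\<^sub>\<infinity>n. nrm \<gamma> (c n))"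
  by (simp add: wiener_norm_def fourier_coeff_eq)

lemma wiener_norm_nonneg: "a \<in> wiener_space \<gamma> \<Longrightarrow> 0 \<le> wiener_norm \<gamma> a"
  unfolding wiener_norm_def
  by (intro infsum_nonneg space.N_nonneg) (auto dest: wiener_space_series intro: wiener_seriesD)

lemma wiener_norm_dominated:
  assumes c: "wiener_series \<gamma> c a" and d: "wiener_series \<gamma> d b"
    and le: "\<And>n. nrm \<gamma> (c n) \<le> nrm \<gamma> (d n)"
  shows "wiener_norm \<gamma> a \<le> wiener_norm \<gamma> b"
  unfolding wiener_norm_eq[OF c] wiener_norm_eq[OF d]
  using wiener_seriesD[OF c] wiener_seriesD[OF d] le by (intro infsum_mono)

lemma wiener_norm_inclusion_bounded:
  assumes sub: "X \<beta> \<subseteq> X \<gamma>"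
  obtains C where "C > 0" "\<And>a. a \<in> wiener_space \<beta> \<Longrightarrow> wiener_norm \<gamma> a \<le> C * wiener_norm \<beta> a"
proof -
  obtain C where C: "C > 0" "\<And>x. x \<in> X \<beta> \<Longrightarrow> nrm \<gamma> x \<le> C * nrm \<beta> x"
    using inclusion_bounded[OF sub] by blast
  have "wiener_norm \<gamma> a \<le> C * wiener_norm \<beta> a" if "a \<in> wiener_space \<beta>" for a
  proof -
    note b = wiener_space_series[OF that]
    note g = wiener_series_mono[OF b sub]
    have "wiener_norm \<gamma> a \<le> (\<Sum>\<^sub>\<infinity>n. C * nrm \<beta> (fourier_coeff a n))"
      unfolding wiener_norm_def using wiener_seriesD[OF b] wiener_seriesD[OF g] C
      by (intro infsum_mono summable_on_cmult_right) auto
    then show ?thesis by (simp add: wiener_norm_def infsum_cmult_right')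
  qed
  then show thesis using that C by blast
qed

text \<open>
  The projections \<open>P\<close> and \<open>Q\<close> are the cases \<open>Z = {..<0}\<close> and \<open>Z = {0..}\<close>. No index is a parameter:
  the function with the given coefficients is the same for all spaces that contain the series.
\<close>

definition frequency_part :: "int set \<Rightarrow> (real \<Rightarrow> 'a) \<Rightarrow> real \<Rightarrow> 'a" where
  "frequency_part Z a =
     (SOME b. \<exists>\<gamma>. wiener_series \<gamma> (\<lambda>n. if n \<in> Z then fourier_coeff a n else 0) b)"

lemma wiener_series_frequency_part:
  assumes a: "a \<in> wiener_space \<gamma>"
  shows "wiener_series \<gamma> (\<lambda>n. if n \<in> Z then fourier_coeff a n else 0) (frequency_part Z a)"
proof -
  define d where "d = (\<lambda>n. if n \<in> Z then fourier_coeff a n else 0)"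
  note C = wiener_seriesD[OF wiener_space_series[OF a]]
  have N0: "nrm \<gamma> 0 = 0" using space.N_eq_0 space.zero_S by blast
  have dX: "d n \<in> X \<gamma>" for n using C space.zero_S by (auto simp: d_def)
  have "(\<lambda>n. nrm \<gamma> (d n)) summable_on UNIV"
    by (rule summable_on_comparison_test[OF C(2)])
      (use C(1) dX N0 space.N_nonneg in \<open>auto simp: d_def\<close>)
  then obtain b where b: "wiener_series \<gamma> d b" using wiener_series_exists[of d \<gamma>] dX by blast
  then have "\<exists>b \<gamma>. wiener_series \<gamma> d b" by blast
  then have "\<exists>\<gamma>. wiener_series \<gamma> d (frequency_part Z a)"
    unfolding frequency_part_def d_def by (rule someI_ex)
  then have "frequency_part Z a = b" using b wiener_series_same_coeffs by blast
  then show ?thesis using b by (simp add: d_def)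
qed

text \<open>
  Completeness of \<open>Y\<^sub>\<gamma>\<close>, in the form needed for geometric series. The double family of all terms
  of all the series is absolutely convergent; summing it over the frequencies first gives the
  values of the sum, summing it over \<open>k\<close> first gives its Fourier coefficients.
\<close>

lemma wiener_space_absolute_series:
  fixes f :: "nat \<Rightarrow> real \<Rightarrow> 'a"
  assumes f: "\<And>k. f k \<in> wiener_space \<gamma>" and sm: "(\<lambda>k. wiener_norm \<gamma> (f k)) summable_on UNIV"
  obtains F where "F \<in> wiener_space \<gamma>"
    and "\<And>t. space.abs_has_sum \<gamma> (\<lambda>k. f k t) UNIV (F t)"
    and "\<And>n. space.abs_has_sum \<gamma> (\<lambda>k. fourier_coeff (f k) n) UNIV (fourier_coeff F n)"
proof -
  define c where "c k n = fourier_coeff (f k) n" for k n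
  have "wiener_series \<gamma> (c k) (f k)" for k
    using wiener_space_series[OF f] by (simp add: c_def[abs_def])
  note C = wiener_seriesD[OF this]
  have nrm_sm: "(\<lambda>(k, n). nrm \<gamma> (c k n)) summable_on UNIV \<times> UNIV"
  proof (rule summable_on_SigmaI)
    show "((\<lambda>n. case (k, n) of (k, n) \<Rightarrow> nrm \<gamma> (c k n)) has_sum wiener_norm \<gamma> (f k)) UNIV" for k
      using has_sum_infsum[OF C(2)[of k]] by (simp add: wiener_norm_def c_def)
  qed (use sm C space.N_nonneg in auto)
  have swap: "inj_on prod.swap (UNIV :: (int \<times> nat) set)" by (auto intro: injI)
  have swap_im: "prod.swap ` (UNIV :: (int \<times> nat) set) = UNIV \<times> UNIV"
    by (metis UNIV_Times_UNIV surj_swap)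
  have nrm_sm': "(\<lambda>(n, k). nrm \<gamma> (c k n)) summable_on UNIV \<times> UNIV"
    using nrm_sm summable_on_reindex[OF swap, of "\<lambda>(k, n). nrm \<gamma> (c k n)"]
    by (simp add: swap_im o_def case_prod_unfold)
  have "(\<lambda>k. nrm \<gamma> (c k n)) summable_on UNIV" for n
    using summable_on_SigmaD1[OF nrm_sm', of n] by simp
  then have "\<exists>s. space.abs_has_sum \<gamma> (\<lambda>k. c k n) UNIV s" for n
    using C by (intro space.abs_has_sum_exists)
  then obtain \<xi> where \<xi>: "\<And>n. space.abs_has_sum \<gamma> (\<lambda>k. c k n) UNIV (\<xi> n)" by metis
  have \<xi>E: "space.abs_has_sum \<gamma> (\<lambda>k. scale (character n t) (c k n)) UNIV (scale (character n t) (\<xi> n))"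
    for n t
    by (rule space.abs_has_sum_bounded_additive[OF banach \<xi>, where C = 1])
      (auto simp: scale_right_distrib space.scale_S space.N_scale)
  have "\<exists>s. space.abs_has_sum \<gamma> (\<lambda>(k, n). scale (character n t) (c k n)) (UNIV \<times> UNIV) s" for t
    using C nrm_sm
    by (intro space.abs_has_sum_exists)
      (auto simp: case_prod_unfold norm_character_scale space.scale_S)
  then obtain F where F:
    "\<And>t. space.abs_has_sum \<gamma> (\<lambda>(k, n). scale (character n t) (c k n)) (UNIV \<times> UNIV) (F t)"
    by metis
  have Ff: "space.abs_has_sum \<gamma> (\<lambda>k. f k t) UNIV (F t)" for t
    by (rule space.abs_has_sum_Sigma(1)[OF F]) (simp add: C(3))
  have F': "space.abs_has_sum \<gamma> (\<lambda>(n, k). scale (character n t) (c k n)) (UNIV \<times> UNIV) (F t)" for t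
    using F[of t] unfolding swap_im[symmetric] space.abs_has_sum_reindex[OF swap]
    by (simp add: case_prod_unfold)
  have FE: "space.abs_has_sum \<gamma> (\<lambda>n. scale (character n t) (\<xi> n)) UNIV (F t)" for t
    by (rule space.abs_has_sum_Sigma(1)[OF F']) (simp add: \<xi>E)
  have \<xi>X: "\<xi> n \<in> X \<gamma>" for n using space.abs_has_sum_limit_in[OF \<xi>] .
  have "wiener_series \<gamma> \<xi> F"
    using space.abs_has_sum_summable[OF FE[of 0]]
    by (intro wiener_seriesI \<xi>X FE) (simp add: norm_character_scale \<xi>X)
  then show thesis
    using that[of F] Ff \<xi> wiener_spaceI fourier_coeff_eq by (auto simp: c_def)
qed

end

section \<open>Products of series\<close>

text \<open>
  Both \<open>x * y\<close> and \<open>y * x\<close> are bounded from \<open>X\<^sub>\<alpha> \<times> X\<^sub>\<beta>\<close> to \<open>X\<^sub>\<beta>\<close>; an abstract pairing \<open>B\<close> covers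
  the two sides of the noncommutative product at once.
\<close>

locale bounded_pairing = banach_inductive_limit scale X nrm
  for scale :: "complex \<Rightarrow> 'a::ab_group_add \<Rightarrow> 'a"
    and X :: "'i \<Rightarrow> 'a set" and nrm :: "'i \<Rightarrow> 'a \<Rightarrow> real" +
  fixes \<alpha> \<beta> :: 'i and K :: real and B :: "'a \<Rightarrow> 'a \<Rightarrow> 'a"
  assumes K_nonneg: "0 \<le> K"
    and B_add_left: "B (x + x') y = B x y + B x' y"
    and B_add_right: "B x (y + y') = B x y + B x y'"
    and B_scale_left: "B (scale z x) y = scale z (B x y)"
    and B_scale_right: "B x (scale z y) = scale z (B x y)"
    and B_in: "x \<in> X \<alpha> \<Longrightarrow> y \<in> X \<beta> \<Longrightarrow> B x y \<in> X \<beta>"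
    and B_bound: "x \<in> X \<alpha> \<Longrightarrow> y \<in> X \<beta> \<Longrightarrow> nrm \<beta> (B x y) \<le> K * nrm \<alpha> x * nrm \<beta> y"
begin

text \<open>
  The double family of products is dominated by the product of the norms, so it has a sum. Summing
  it row by row identifies that sum, as \<open>B\<close> is bounded in each argument.
\<close>

lemma abs_has_sum_pair:
  assumes f: "space.abs_has_sum \<alpha> f I s" and g: "space.abs_has_sum \<beta> g J r"
  shows "space.abs_has_sum \<beta> (\<lambda>(i, j). B (f i) (g j)) (I \<times> J) (B s r)"
    and "(\<Sum>\<^sub>\<infinity>(i, j)\<in>I \<times> J. nrm \<beta> (B (f i) (g j)))
           \<le> K * (\<Sum>\<^sub>\<infinity>i\<in>I. nrm \<alpha> (f i)) * (\<Sum>\<^sub>\<infinity>j\<in>J. nrm \<beta> (g j))"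
proof -
  note F = space.abs_has_sumD[OF f] and G = space.abs_has_sumD[OF g]
  define nf where "nf = (\<lambda>i. nrm \<alpha> (f i))"
  define ng where "ng = (\<lambda>j. nrm \<beta> (g j))"
  have nf: "nf summable_on I" and ng: "ng summable_on J" using F G by (auto simp: nf_def ng_def)
  have nf0: "0 \<le> nf i" if "i \<in> I" for i using F that by (simp add: nf_def space.N_nonneg)
  have ng0: "0 \<le> ng j" if "j \<in> J" for j using G that by (simp add: ng_def space.N_nonneg)
  have row: "((\<lambda>j. K * nf i * ng j) has_sum K * nf i * infsum ng J) J" for i
    using has_sum_infsum[OF ng] by (rule has_sum_cmult_right)
  have dom: "(\<lambda>(i, j). K * nf i * ng j) summable_on I \<times> J"
    by (rule summable_on_SigmaI[where g = "\<lambda>i. K * nf i * infsum ng J"])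
      (use row nf nf0 ng0 K_nonneg in
        \<open>auto intro!: summable_on_cmult_left summable_on_cmult_right mult_nonneg_nonneg\<close>)
  have le: "nrm \<beta> (B (f i) (g j)) \<le> K * nf i * ng j" if "i \<in> I" "j \<in> J" for i j
    using that F G by (simp add: nf_def ng_def B_bound)
  have in_space: "B (f i) (g j) \<in> X \<beta>" if "i \<in> I" "j \<in> J" for i j
    using that F G by (intro B_in)
  have sm: "(\<lambda>(i, j). nrm \<beta> (B (f i) (g j))) summable_on I \<times> J"
    by (rule summable_on_comparison_test[OF dom])
      (use le in_space space.N_nonneg in auto)
  have "(\<Sum>\<^sub>\<infinity>(i, j)\<in>I \<times> J. nrm \<beta> (B (f i) (g j))) \<le> (\<Sum>\<^sub>\<infinity>(i, j)\<in>I \<times> J. K * nf i * ng j)"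
    by (rule infsum_mono[OF sm dom]) (use le in auto)
  also have "\<dots> = (\<Sum>\<^sub>\<infinity>i\<in>I. K * nf i * infsum ng J)"
    using infsum_Sigma'_banach[OF dom] infsumI[OF row] by simp
  also have "\<dots> = K * infsum nf I * infsum ng J"
    by (simp add: infsum_cmult_left' infsum_cmult_right')
  finally show "(\<Sum>\<^sub>\<infinity>(i, j)\<in>I \<times> J. nrm \<beta> (B (f i) (g j)))
           \<le> K * (\<Sum>\<^sub>\<infinity>i\<in>I. nrm \<alpha> (f i)) * (\<Sum>\<^sub>\<infinity>j\<in>J. nrm \<beta> (g j))"
    by (simp add: nf_def ng_def)
  have "\<exists>p. space.abs_has_sum \<beta> (\<lambda>(i, j). B (f i) (g j)) (I \<times> J) p"
    using sm in_space by (intro space.abs_has_sum_exists) (auto simp: case_prod_unfold)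
  then obtain p where p: "space.abs_has_sum \<beta> (\<lambda>(i, j). B (f i) (g j)) (I \<times> J) p" by blast
  have rows: "space.abs_has_sum \<beta> (\<lambda>j. B (f i) (g j)) J (B (f i) r)" if "i \<in> I" for i
    by (rule space.abs_has_sum_bounded_additive[OF banach g, where C = "K * nrm \<alpha> (f i)"])
      (use that F in \<open>auto simp: B_add_right B_in B_bound\<close>)
  have "space.abs_has_sum \<beta> (\<lambda>i. B (f i) r) I p"
    by (rule space.abs_has_sum_Sigma(1)[OF p]) (simp add: rows)
  moreover have "space.abs_has_sum \<beta> (\<lambda>i. B (f i) r) I (B s r)"
    by (rule space.abs_has_sum_bounded_additive[OF banach f, where C = "K * nrm \<beta> r"
          and L = "\<lambda>x. B x r"])
      (use G B_bound in \<open>auto simp: B_add_left B_in mult_ac\<close>)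
  ultimately have "p = B s r" by (rule space.abs_has_sum_unique)
  then show "space.abs_has_sum \<beta> (\<lambda>(i, j). B (f i) (g j)) (I \<times> J) (B s r)" using p by simp
qed

text \<open>
  The coefficients of a product are the convolution of the coefficients: in the double sum, the
  pairs \<open>(k, l)\<close> are grouped by the frequency \<open>n = k + l\<close>. The norm bound is inherited from the
  double family.
\<close>

lemma wiener_series_pair:
  assumes c: "wiener_series \<alpha> c a" and d: "wiener_series \<beta> d b"
  obtains u where "wiener_series \<beta> u (\<lambda>t. B (a t) (b t))"
    and "\<And>n. space.abs_has_sum \<beta> (\<lambda>k. B (c k) (d (n - k))) UNIV (u n)"
    and "(\<Sum>\<^sub>\<infinity>n. nrm \<beta> (u n)) \<le> K * (\<Sum>\<^sub>\<infinity>n. nrm \<alpha> (c n)) * (\<Sum>\<^sub>\<infinity>n. nrm \<beta> (d n))"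
proof -
  note C = wiener_seriesD[OF c] and D = wiener_seriesD[OF d]
  define w where "w t = (\<lambda>(n, k). scale (character n t) (B (c k) (d (n - k))))" for t
  \<comment> \<open>The pairs \<open>(k, l)\<close> are indexed by their frequency \<open>n = k + l\<close> and by \<open>k\<close>.\<close>
  define shear :: "int \<times> int \<Rightarrow> int \<times> int" where "shear = (\<lambda>(n, k). (k, n - k))"
  have inj: "inj_on shear UNIV" by (auto simp: shear_def intro!: injI)
  have im: "shear ` UNIV = UNIV \<times> UNIV"
  proof -
    have "(k, l) = shear (k + l, k)" for k l by (simp add: shear_def)
    then show ?thesis by (metis UNIV_I UNIV_Times_UNIV UNIV_eq_I image_eqI surj_pair)
  qed
  have cd: "scale (character n t) (B (c k) (d (n - k)))
      = B (scale (character k t) (c k)) (scale (character (n - k) t) (d (n - k)))" for n k t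
    by (simp add: B_scale_left B_scale_right exp_add[symmetric] algebra_simps)
  have w: "space.abs_has_sum \<beta> (w t) (UNIV \<times> UNIV) (B (a t) (b t))" for t
    using abs_has_sum_pair(1)[OF C(3) D(3), of t t,
        folded im, unfolded space.abs_has_sum_reindex[OF inj]]
    by (simp add: shear_def w_def cd case_prod_unfold)
  have w0: "w 0 p = B (c (snd p)) (d (fst p - snd p))" for p by (simp add: w_def case_prod_unfold)
  have wN: "(\<Sum>\<^sub>\<infinity>p\<in>UNIV \<times> UNIV. nrm \<beta> (w 0 p))
      \<le> K * (\<Sum>\<^sub>\<infinity>n. nrm \<alpha> (c n)) * (\<Sum>\<^sub>\<infinity>n. nrm \<beta> (d n))"
    using abs_has_sum_pair(2)[OF C(3) D(3), of 0 0, folded im, unfolded infsum_reindex[OF inj]]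
    by (simp add: shear_def w0 o_def case_prod_unfold)
  have "\<exists>s. space.abs_has_sum \<beta> (\<lambda>k. B (c k) (d (n - k))) UNIV s" for n
  proof (rule space.abs_has_sum_exists)
    have "(\<lambda>(n, k). nrm \<beta> (B (c k) (d (n - k)))) summable_on UNIV \<times> UNIV"
      using space.abs_has_sum_summable[OF w, of 0] by (simp add: w_def case_prod_unfold)
    from summable_on_SigmaD1[OF this, of n]
    show "(\<lambda>k. nrm \<beta> (B (c k) (d (n - k)))) summable_on UNIV" by simp
  qed (use C D in \<open>auto intro: B_in\<close>)
  then obtain u where u: "\<And>n. space.abs_has_sum \<beta> (\<lambda>k. B (c k) (d (n - k))) UNIV (u n)"
    by metis
  have uX: "u n \<in> X \<beta>" for n using space.abs_has_sum_limit_in[OF u] .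
  have col: "space.abs_has_sum \<beta> (\<lambda>k. w t (n, k)) UNIV (scale (character n t) (u n))" for n t
    unfolding w_def prod.case
    by (rule space.abs_has_sum_bounded_additive[OF banach u, where C = 1])
      (auto simp: scale_right_distrib space.scale_S space.N_scale)
  \<comment> \<open>At \<open>t = 0\<close> all characters are \<open>1\<close>, and the bound on the grouped family is that on \<open>u\<close>.\<close>
  note uw = space.abs_has_sum_Sigma[OF w col]
  have "(\<Sum>\<^sub>\<infinity>n. nrm \<beta> (u n)) \<le> (\<Sum>\<^sub>\<infinity>p\<in>UNIV \<times> UNIV. nrm \<beta> (w 0 p))"
    using uw(2)[of 0] by simp
  moreover have "wiener_series \<beta> u (\<lambda>t. B (a t) (b t))"
    using space.abs_has_sum_summable[OF uw(1)[of 0]] by (intro wiener_seriesI uX uw(1)) simp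
  ultimately show thesis using that u wN by force
qed

end

section \<open>Frequency support and projections\<close>

context banach_inductive_limit
begin

definition frequencies_in :: "int set \<Rightarrow> (real \<Rightarrow> 'a) set" where
  "frequencies_in Z = {a \<in> wiener_algebra. \<forall>n. n \<notin> Z \<longrightarrow> fourier_coeff a n = 0}"

lemma wiener_plus_eq: "wiener_plus = frequencies_in {..<0}"
  and wiener_minus0_eq: "wiener_minus0 = frequencies_in {0..}"
  unfolding wiener_plus_def wiener_minus0_def frequencies_in_def by auto

lemma frequencies_inI:
  "wiener_series \<gamma> c a \<Longrightarrow> (\<And>n. n \<notin> Z \<Longrightarrow> c n = 0) \<Longrightarrow> a \<in> frequencies_in Z"
  unfolding frequencies_in_def wiener_algebra_def
  by (auto simp: fourier_coeff_eq dest: wiener_spaceI)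

lemma wiener_algebra_common_index:
  assumes "a \<in> wiener_algebra" "b \<in> wiener_algebra"
  obtains \<gamma> where "a \<in> wiener_space \<gamma>" "b \<in> wiener_space \<gamma>"
proof -
  obtain \<alpha> \<beta> where ab: "a \<in> wiener_space \<alpha>" "b \<in> wiener_space \<beta>"
    using assms unfolding wiener_algebra_def by auto
  obtain \<gamma> where "X \<alpha> \<subseteq> X \<gamma>" "X \<beta> \<subseteq> X \<gamma>" using directed by blast
  then show thesis using that[of \<gamma>] ab wiener_space_mono by blast
qed

lemma zero_in_frequencies_in: "0 \<in> frequencies_in Z"
proof -
  \<comment> \<open>The zero function is the case \<open>x = 0\<close> of a constant function, which has the frequency \<open>0\<close> only.\<close>
  have "wiener_series \<gamma> (\<lambda>n. if n = 0 then 0 else 0) (\<lambda>t. 0)" for \<gamma>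
    by (rule wiener_series_single) (rule space.zero_S)
  then show ?thesis by (auto simp: zero_fun_def intro: frequencies_inI)
qed

lemma frequencies_in_diff:
  assumes "a \<in> frequencies_in Z" "b \<in> frequencies_in Z"
  shows "a - b \<in> frequencies_in Z"
proof -
  obtain \<gamma> where "a \<in> wiener_space \<gamma>" "b \<in> wiener_space \<gamma>"
    using assms wiener_algebra_common_index unfolding frequencies_in_def by blast
  from wiener_series_diff[OF this[THEN wiener_space_series]] show ?thesis
    by (rule frequencies_inI) (use assms in \<open>auto simp: frequencies_in_def\<close>)
qed

lemma frequencies_in_add:
  assumes "a \<in> frequencies_in Z" "b \<in> frequencies_in Z"
  shows "a + b \<in> frequencies_in Z"
  using frequencies_in_diff[OF assms(1) frequencies_in_diff[OF zero_in_frequencies_in assms(2)]]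
  by simp

lemma frequencies_in_disjoint:
  assumes "Z \<inter> Z' = {}" shows "frequencies_in Z \<inter> frequencies_in Z' \<subseteq> {0}"
proof
  fix a assume a: "a \<in> frequencies_in Z \<inter> frequencies_in Z'"
  then obtain \<gamma> where "a \<in> wiener_space \<gamma>"
    unfolding frequencies_in_def wiener_algebra_def by blast
  note s = wiener_space_series[OF this]
  have "fourier_coeff a = (\<lambda>n. if n = 0 then 0 else 0)"
    using a assms unfolding frequencies_in_def by auto
  then have "wiener_series \<gamma> (\<lambda>n. if n = 0 then 0 else 0) a" using s by simp
  moreover have "wiener_series \<gamma> (\<lambda>n. if n = 0 then 0 else 0) (\<lambda>t. 0)"
    by (rule wiener_series_single) (rule space.zero_S)
  ultimately have "a = (\<lambda>t. 0)" by (rule wiener_series_same_coeffs)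
  then show "a \<in> {0}" by (simp add: zero_fun_def)
qed

lemma frequency_part:
  assumes a: "a \<in> wiener_space \<gamma>"
  shows "frequency_part Z a \<in> wiener_space \<gamma>" "frequency_part Z a \<in> frequencies_in Z"
    and "wiener_norm \<gamma> (frequency_part Z a) \<le> wiener_norm \<gamma> a"
    and "frequency_part Z a - a \<in> wiener_space \<gamma>" "frequency_part Z a - a \<in> frequencies_in (- Z)"
    and "wiener_norm \<gamma> (frequency_part Z a - a) \<le> wiener_norm \<gamma> a"
proof -
  note s = wiener_space_series[OF a]
  note p = wiener_series_frequency_part[OF a, of Z]
  note d = wiener_series_diff[OF p s]
  have 0: "nrm \<gamma> 0 \<le> nrm \<gamma> (fourier_coeff a n)"
    and m: "nrm \<gamma> (- fourier_coeff a n) \<le> nrm \<gamma> (fourier_coeff a n)" for n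
    using wiener_seriesD(1)[OF s, of n] space.N_eq_0[of 0 \<gamma>] space.zero_S
    by (simp_all add: space.N_nonneg space.N_minus)
  show "frequency_part Z a \<in> wiener_space \<gamma>" "frequency_part Z a - a \<in> wiener_space \<gamma>"
    using p d by (auto intro: wiener_spaceI)
  show "frequency_part Z a \<in> frequencies_in Z" "frequency_part Z a - a \<in> frequencies_in (- Z)"
    by (rule frequencies_inI[OF p] frequencies_inI[OF d]; simp)+
  show "wiener_norm \<gamma> (frequency_part Z a) \<le> wiener_norm \<gamma> a"
    "wiener_norm \<gamma> (frequency_part Z a - a) \<le> wiener_norm \<gamma> a"
    by (rule wiener_norm_dominated[OF p s] wiener_norm_dominated[OF d s]; use 0 m in simp)+
qed

section \<open>Evaluation of formal power series at 1\<close>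

text \<open>
  The coefficients are functions of \<open>t\<close>, and convergence is only pointwise in \<open>t\<close>, though in one
  space for all \<open>t\<close>. This is enough for Cauchy products and keeps the norms of the Wiener algebra
  out of the argument.
\<close>

definition evaluates :: "(real \<Rightarrow> 'a) fps \<Rightarrow> (real \<Rightarrow> 'a) \<Rightarrow> bool" where
  "evaluates f F \<longleftrightarrow> (\<exists>\<gamma>. \<forall>t. space.abs_has_sum \<gamma> (\<lambda>k. fps_nth f k t) UNIV (F t))"

lemma evaluates_unique:
  assumes "evaluates f F" "evaluates f G" shows "F = G"
  using assms abs_has_sum_unique_index unfolding evaluates_def by (intro ext) blast

lemma evaluates_finite:
  assumes X: "\<And>k t. k \<le> n \<Longrightarrow> fps_nth f k t \<in> X \<gamma>" and z: "\<And>k. k > n \<Longrightarrow> fps_nth f k = 0"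
  shows "evaluates f (\<lambda>t. \<Sum>k\<le>n. fps_nth f k t)"
  unfolding evaluates_def
proof (intro exI allI)
  fix t
  show "space.abs_has_sum \<gamma> (\<lambda>k. fps_nth f k t) UNIV (\<Sum>k\<le>n. fps_nth f k t)"
    by (rule space.abs_has_sum_finite_support) (use X z in auto)
qed

text \<open>
  The terms of the Neumann series for \<open>u = v + P (L u)\<close>, where \<open>P\<close> is the projection onto the
  frequencies in \<open>Z\<close>. They are the coefficients of the formal series \<open>x\<close> and \<open>y\<close>.
\<close>

primrec projected_iterates ::
    "int set \<Rightarrow> ((real \<Rightarrow> 'a) \<Rightarrow> real \<Rightarrow> 'a) \<Rightarrow> (real \<Rightarrow> 'a) \<Rightarrow> nat \<Rightarrow> real \<Rightarrow> 'a" where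
  "projected_iterates Z L v 0 = v"
| "projected_iterates Z L v (Suc k) = frequency_part Z (L (projected_iterates Z L v k))"

text \<open>
  The bound starts with \<open>L v\<close> instead of \<open>v\<close>: for \<open>v = 1\<close> and \<open>L\<close> multiplication by \<open>c\<close>, the unit
  need not lie in \<open>Y\<^sub>\<beta>\<close>, but \<open>L v = c\<close> does.
\<close>

lemma projected_iterates_bound:
  assumes v: "L v \<in> wiener_space \<beta>" and q: "0 \<le> q"
    and L: "\<And>u. u \<in> wiener_space \<beta> \<Longrightarrow> L u \<in> wiener_space \<beta> \<and> wiener_norm \<beta> (L u) \<le> q * wiener_norm \<beta> u"
  shows "L (projected_iterates Z L v k) \<in> wiener_space \<beta> \<and>
    wiener_norm \<beta> (L (projected_iterates Z L v k)) \<le> wiener_norm \<beta> (L v) * q ^ k"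
proof (induction k)
  case (Suc k)
  define u where "u = L (projected_iterates Z L v k)"
  note p = frequency_part[of u \<beta> Z]
  have u: "u \<in> wiener_space \<beta>" "wiener_norm \<beta> u \<le> wiener_norm \<beta> (L v) * q ^ k"
    using Suc by (auto simp: u_def)
  have "wiener_norm \<beta> (L (frequency_part Z u)) \<le> q * wiener_norm \<beta> (frequency_part Z u)"
    using L p(1) u by blast
  also have "\<dots> \<le> q * (wiener_norm \<beta> (L v) * q ^ k)"
    using p(3) u q by (intro mult_left_mono) auto
  finally show ?case using L p(1) u by (simp add: u_def mult_ac)
qed (use v in simp)

end

lemma sum_fun_apply: "sum u A t = (\<Sum>i\<in>A. u i t)"
  for u :: "'b \<Rightarrow> 'c \<Rightarrow> 'd::comm_monoid_add"
  by (induction A rule: infinite_finite_induct) auto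

text \<open>
  The series \<open>1 - c X\<close>, given by its coefficients because the usual rules for \<^const>\<open>fps_X\<close>
  presuppose \<open>1 \<noteq> 0\<close>.
\<close>

definition one_minus_X :: "'r::{ring, monoid_mult} \<Rightarrow> 'r fps" where
  "one_minus_X c = Abs_fps (\<lambda>k. if k = 0 then 1 else if k = 1 then - c else 0)"

lemma one_minus_X_mult_nth:
  fixes x :: "'r::{ring, monoid_mult} fps"
  shows "fps_nth (one_minus_X c * x) (Suc k) = fps_nth x (Suc k) - c * fps_nth x k"
    and "fps_nth (x * one_minus_X c) (Suc k) = fps_nth x (Suc k) - fps_nth x k * c"
proof -
  have "fps_nth (one_minus_X c * x) (Suc k) =
      (\<Sum>i=0..Suc k. (if i = 0 then fps_nth x (Suc k) else 0) + (if i = 1 then - c * fps_nth x k else 0))"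
    unfolding fps_mult_nth one_minus_X_def by (intro sum.cong) auto
  also have "\<dots> = fps_nth x (Suc k) - c * fps_nth x k" unfolding sum.distrib by simp
  finally show "fps_nth (one_minus_X c * x) (Suc k) = fps_nth x (Suc k) - c * fps_nth x k" .
  have "fps_nth (x * one_minus_X c) (Suc k) =
      (\<Sum>i=0..Suc k. (if i = Suc k then fps_nth x (Suc k) else 0) + (if i = k then - (fps_nth x k * c) else 0))"
    unfolding fps_mult_nth one_minus_X_def by (intro sum.cong) auto
  also have "\<dots> = fps_nth x (Suc k) - fps_nth x k * c" unfolding sum.distrib by simp
  finally show "fps_nth (x * one_minus_X c) (Suc k) = fps_nth x (Suc k) - fps_nth x k * c" .
qed

context unital_strong_algebra
begin

lemma pairing_left:
  assumes "X (h \<alpha>) \<subseteq> X \<beta>" shows "bounded_pairing scale X nrm \<alpha> \<beta> (A \<beta> \<alpha>) (*)"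
  by unfold_locales
    (use assms A_pos mult_left scale_mult_left scale_mult_right in
      \<open>auto simp: distrib_left distrib_right less_imp_le\<close>)

lemma pairing_right:
  assumes "X (h \<alpha>) \<subseteq> X \<beta>" shows "bounded_pairing scale X nrm \<alpha> \<beta> (A \<beta> \<alpha>) (\<lambda>x y. y * x)"
  by unfold_locales
    (use assms A_pos mult_right scale_mult_left scale_mult_right in
      \<open>auto simp: distrib_left distrib_right less_imp_le\<close>)

text \<open>
  The strong algebra inequalities carry over to the Wiener spaces with the same \<open>h\<close> and the same
  constants.
\<close>

lemma wiener_mult_bound:
  assumes sub: "X (h \<alpha>) \<subseteq> X \<beta>" and c: "c \<in> wiener_space \<alpha>" and v: "v \<in> wiener_space \<beta>"
  shows "c * v \<in> wiener_space \<beta>" "wiener_norm \<beta> (c * v) \<le> A \<beta> \<alpha> * wiener_norm \<alpha> c * wiener_norm \<beta> v"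
    and "v * c \<in> wiener_space \<beta>" "wiener_norm \<beta> (v * c) \<le> A \<beta> \<alpha> * wiener_norm \<alpha> c * wiener_norm \<beta> v"
proof -
  note s = wiener_space_series[OF c] wiener_space_series[OF v]
  interpret l: bounded_pairing scale X nrm \<alpha> \<beta> "A \<beta> \<alpha>" "(*)" by (rule pairing_left[OF sub])
  interpret r: bounded_pairing scale X nrm \<alpha> \<beta> "A \<beta> \<alpha>" "\<lambda>x y. y * x" by (rule pairing_right[OF sub])
  obtain u where u: "wiener_series \<beta> u (c * v)"
    "(\<Sum>\<^sub>\<infinity>n. nrm \<beta> (u n)) \<le> A \<beta> \<alpha> * wiener_norm \<alpha> c * wiener_norm \<beta> v"
    using l.wiener_series_pair[OF s] by (auto simp: wiener_norm_def times_fun_def)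
  show "c * v \<in> wiener_space \<beta>" "wiener_norm \<beta> (c * v) \<le> A \<beta> \<alpha> * wiener_norm \<alpha> c * wiener_norm \<beta> v"
    using u by (auto simp: wiener_norm_eq[OF u(1)] intro: wiener_spaceI)
  obtain u' where u': "wiener_series \<beta> u' (v * c)"
    "(\<Sum>\<^sub>\<infinity>n. nrm \<beta> (u' n)) \<le> A \<beta> \<alpha> * wiener_norm \<alpha> c * wiener_norm \<beta> v"
    using r.wiener_series_pair[OF s] by (auto simp: wiener_norm_def times_fun_def)
  show "v * c \<in> wiener_space \<beta>" "wiener_norm \<beta> (v * c) \<le> A \<beta> \<alpha> * wiener_norm \<alpha> c * wiener_norm \<beta> v"
    using u' by (auto simp: wiener_norm_eq[OF u'(1)] intro: wiener_spaceI)
qed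

lemma obtain_product_index:
  obtains \<delta> where "X (h \<gamma>) \<subseteq> X \<delta>" "X \<gamma> \<subseteq> X \<delta>"
  using directed by blast

text \<open>
  Each term of the convolution at a frequency \<open>n = k + l\<close> outside \<open>Z\<close> has \<open>k\<close> or \<open>l\<close> outside \<open>Z\<close>.
\<close>

lemma frequencies_in_mult:
  assumes Z: "\<And>k l. k \<in> Z \<Longrightarrow> l \<in> Z \<Longrightarrow> k + l \<in> Z"
    and a: "a \<in> frequencies_in Z" and b: "b \<in> frequencies_in Z"
  shows "a * b \<in> frequencies_in Z"
proof -
  obtain \<gamma> where ab: "a \<in> wiener_space \<gamma>" "b \<in> wiener_space \<gamma>"
    using a b wiener_algebra_common_index unfolding frequencies_in_def by blast
  obtain \<delta> where sub: "X (h \<gamma>) \<subseteq> X \<delta>" "X \<gamma> \<subseteq> X \<delta>" by (rule obtain_product_index)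
  interpret l: bounded_pairing scale X nrm \<gamma> \<delta> "A \<delta> \<gamma>" "(*)" by (rule pairing_left[OF sub(1)])
  have "wiener_series \<delta> (fourier_coeff b) b"
    using ab sub wiener_space_series wiener_series_mono by blast
  from l.wiener_series_pair[OF wiener_space_series[OF ab(1)] this]
  obtain u where u: "wiener_series \<delta> u (\<lambda>t. a t * b t)"
    "\<And>n. space.abs_has_sum \<delta> (\<lambda>k. fourier_coeff a k * fourier_coeff b (n - k)) UNIV (u n)"
    by blast
  have "u n = 0" if "n \<notin> Z" for n
  proof -
    have "fourier_coeff a k * fourier_coeff b (n - k) = 0" for k
      using a b Z[of k "n - k"] \<open>n \<notin> Z\<close> unfolding frequencies_in_def
      by (cases "k \<in> Z"; cases "n - k \<in> Z") auto
    then have "space.abs_has_sum \<delta> (\<lambda>k. 0) (UNIV :: int set) (u n)" using u(2)[of n] by simp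
    moreover have "space.abs_has_sum \<delta> (\<lambda>k. 0) (UNIV :: int set) 0"
      using space.abs_has_sum_finite_support[of "{}" UNIV "\<lambda>k. 0" \<delta>] by simp
    ultimately show ?thesis by (rule space.abs_has_sum_unique)
  qed
  with u(1) show ?thesis by (intro frequencies_inI[of \<delta> u]) (auto simp: times_fun_def)
qed

lemma wiener_algebra_mult:
  "a \<in> wiener_algebra \<Longrightarrow> b \<in> wiener_algebra \<Longrightarrow> a * b \<in> wiener_algebra"
  using frequencies_in_mult[of UNIV a b] by (simp add: frequencies_in_def)

text \<open>
  The double series of products is summed along the diagonals \<open>i + j = n\<close>. The two factors may
  converge in different spaces, and the product converges in a third one.
\<close>

lemma evaluates_mult:
  assumes f: "evaluates f F" and g: "evaluates g G"
  shows "evaluates (f * g) (F * G)"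
proof -
  obtain \<gamma>1 \<gamma>2 where fg:
    "\<And>t. space.abs_has_sum \<gamma>1 (\<lambda>k. fps_nth f k t) UNIV (F t)"
    "\<And>t. space.abs_has_sum \<gamma>2 (\<lambda>k. fps_nth g k t) UNIV (G t)"
    using f g unfolding evaluates_def by blast
  obtain \<gamma> where g12: "X \<gamma>1 \<subseteq> X \<gamma>" "X \<gamma>2 \<subseteq> X \<gamma>" using directed by blast
  obtain \<delta> where sub: "X (h \<gamma>) \<subseteq> X \<delta>" "X \<gamma> \<subseteq> X \<delta>" by (rule obtain_product_index)
  interpret l: bounded_pairing scale X nrm \<gamma> \<delta> "A \<delta> \<gamma>" "(*)" by (rule pairing_left[OF sub(1)])
  define sh :: "nat \<times> nat \<Rightarrow> nat \<times> nat" where "sh = (\<lambda>(n, i). (i, n - i))"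
  define T where "T = Sigma (UNIV :: nat set) (\<lambda>n. {0..n})"
  have inj: "inj_on sh T" by (auto simp: sh_def T_def intro!: inj_onI)
  have im: "sh ` T = UNIV \<times> UNIV"
  proof -
    have "(i, j) = sh (i + j, i)" "(i + j, i) \<in> T" for i j by (auto simp: sh_def T_def)
    then show ?thesis by (metis UNIV_Times_UNIV UNIV_eq_I image_eqI surj_pair)
  qed
  have "space.abs_has_sum \<delta> (\<lambda>n. fps_nth (f * g) n t) UNIV ((F * G) t)" for t
  proof -
    have "space.abs_has_sum \<delta> (\<lambda>(i, j). fps_nth f i t * fps_nth g j t) (UNIV \<times> UNIV) (F t * G t)"
      by (rule l.abs_has_sum_pair[OF abs_has_sum_mono[OF g12(1) fg(1)]
            abs_has_sum_mono[OF sub(2) abs_has_sum_mono[OF g12(2) fg(2)]]])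
    then have *: "space.abs_has_sum \<delta> (\<lambda>(n, i). fps_nth f i t * fps_nth g (n - i) t)
        (Sigma UNIV (\<lambda>n. {0..n})) (F t * G t)"
      unfolding im[symmetric] space.abs_has_sum_reindex[OF inj] T_def[symmetric]
      by (simp add: sh_def case_prod_unfold)
    have inX: "fps_nth f i t * fps_nth g j t \<in> X \<delta>" for i j
    proof (rule l.B_in)
      show "fps_nth f i t \<in> X \<gamma>" using space.abs_has_sum_in[OF fg(1)] g12 by blast
      show "fps_nth g j t \<in> X \<delta>" using space.abs_has_sum_in[OF fg(2)] g12 sub by blast
    qed
    have "space.abs_has_sum \<delta> (\<lambda>n. \<Sum>i=0..n. fps_nth f i t * fps_nth g (n - i) t) UNIV (F t * G t)"
      by (rule space.abs_has_sum_Sigma(1)[OF *])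
        (use inX in \<open>auto intro!: space.abs_has_sum_finite_support\<close>)
    then show ?thesis by (simp add: fps_mult_nth sum_fun_apply)
  qed
  then show ?thesis unfolding evaluates_def by blast
qed

lemma one_in_some_space: obtains \<gamma> where "1 \<in> X \<gamma>" "X \<beta> \<subseteq> X \<gamma>"
proof -
  obtain \<delta> where "1 \<in> X \<delta>" using union by blast
  moreover obtain \<gamma> where "X \<delta> \<subseteq> X \<gamma>" "X \<beta> \<subseteq> X \<gamma>" using directed by blast
  ultimately show thesis using that by blast
qed

lemma evaluates_one: "evaluates 1 1"
proof -
  obtain \<gamma> where "1 \<in> X \<gamma>" by (rule one_in_some_space)
  then have "evaluates 1 (\<lambda>t. \<Sum>k\<le>0. fps_nth 1 k t)" by (intro evaluates_finite[of _ _ \<gamma>]) auto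
  then show ?thesis by (simp add: one_fun_def)
qed

lemma evaluates_one_minus_X:
  assumes "c \<in> wiener_algebra" shows "evaluates (one_minus_X c) (1 - c)"
proof -
  obtain \<beta> where "c \<in> wiener_space \<beta>" using assms unfolding wiener_algebra_def by blast
  then have c: "c t \<in> X \<beta>" for t
    using space.abs_has_sum_limit_in wiener_seriesD(3) wiener_space_series by blast
  obtain \<gamma> where \<gamma>: "1 \<in> X \<gamma>" "X \<beta> \<subseteq> X \<gamma>" by (rule one_in_some_space)
  have m: "- c t \<in> X \<gamma>" for t using c \<gamma> space.diff_S[OF space.zero_S] by fastforce
  have "evaluates (one_minus_X c) (\<lambda>t. \<Sum>k\<le>1. fps_nth (one_minus_X c) k t)"
    by (rule evaluates_finite[of _ _ \<gamma>]) (use \<gamma> m in \<open>auto simp: one_minus_X_def\<close>)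
  then show ?thesis by (simp add: one_minus_X_def fun_diff_def)
qed

text \<open>
  The geometric estimate concerns the terms from \<open>k = 1\<close> on, which lie in \<open>Y\<^sub>\<beta>\<close>; the sum is
  formed in a larger space that contains the unit as well.
\<close>

lemma geometric_evaluates:
  assumes f0: "fps_nth f 0 = 1" and f: "\<And>k. fps_nth f (Suc k) \<in> wiener_space \<beta>"
    and le: "\<And>k. wiener_norm \<beta> (fps_nth f (Suc k)) \<le> C * q ^ k" and q: "0 \<le> q" "q < 1"
    and Z: "\<And>k. fps_nth f (Suc k) \<in> frequencies_in Z"
  obtains F where "evaluates f F" "F \<in> wiener_algebra" "F - 1 \<in> frequencies_in Z"
proof -
  obtain \<gamma> where \<gamma>: "1 \<in> X \<gamma>" "X \<beta> \<subseteq> X \<gamma>" by (rule one_in_some_space)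
  obtain D where D: "D > 0" "\<And>a. a \<in> wiener_space \<beta> \<Longrightarrow> wiener_norm \<gamma> a \<le> D * wiener_norm \<beta> a"
    using wiener_norm_inclusion_bounded[OF \<gamma>(2)] by blast
  have one: "wiener_series \<gamma> (\<lambda>n. if n = 0 then 1 else 0) 1"
    using wiener_series_single[OF \<gamma>(1)] by (simp add: one_fun_def)
  have f_in: "fps_nth f k \<in> wiener_space \<gamma>" for k
    using f0 f wiener_space_mono[OF \<gamma>(2)] wiener_spaceI[OF one] by (cases k) auto
  have "summable (\<lambda>k. wiener_norm \<gamma> (fps_nth f (Suc k)))"
  proof (rule summable_comparison_test)
    have "wiener_norm \<gamma> (fps_nth f (Suc k)) \<le> D * (C * q ^ k)" for k
      using D(2)[OF f, of k] mult_left_mono[OF le, of D k] D(1) by linarith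
    then show "\<exists>N. \<forall>k\<ge>N. norm (wiener_norm \<gamma> (fps_nth f (Suc k))) \<le> D * (C * q ^ k)"
      using wiener_norm_nonneg[OF f_in] by simp
    show "summable (\<lambda>k. D * (C * q ^ k))"
      using q by (intro summable_mult summable_geometric) auto
  qed
  then have "summable (\<lambda>k. wiener_norm \<gamma> (fps_nth f k))"
    by (rule summable_Suc_iff[THEN iffD1])
  then have "(\<lambda>k. wiener_norm \<gamma> (fps_nth f k)) summable_on UNIV"
    using wiener_norm_nonneg[OF f_in] by (intro norm_summable_imp_summable_on) simp
  then obtain F where F: "F \<in> wiener_space \<gamma>"
    "\<And>t. space.abs_has_sum \<gamma> (\<lambda>k. fps_nth f k t) UNIV (F t)"
    "\<And>n. space.abs_has_sum \<gamma> (\<lambda>k. fourier_coeff (fps_nth f k) n) UNIV (fourier_coeff F n)"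
    using wiener_space_absolute_series[of "fps_nth f" \<gamma>] f_in by blast
  have "fourier_coeff F n - (if n = 0 then 1 else 0) = 0" if "n \<notin> Z" for n
  proof -
    have "fourier_coeff (fps_nth f k) n = 0" if "k \<notin> {0}" for k
      using Z[of "k - 1"] that \<open>n \<notin> Z\<close> unfolding frequencies_in_def by auto
    moreover have "fourier_coeff (fps_nth f 0) n \<in> X \<gamma>"
      using wiener_seriesD(1)[OF wiener_space_series[OF f_in]] .
    ultimately have "space.abs_has_sum \<gamma> (\<lambda>k. fourier_coeff (fps_nth f k) n) UNIV
        (\<Sum>k\<in>{0}. fourier_coeff (fps_nth f k) n)"
      by (intro space.abs_has_sum_finite_support) auto
    then have "fourier_coeff F n = fourier_coeff (fps_nth f 0) n"
      using space.abs_has_sum_unique[OF F(3)] by simp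
    then show ?thesis using fourier_coeff_eq[OF one] by (simp add: f0)
  qed
  then have "F - 1 \<in> frequencies_in Z"
    by (rule frequencies_inI[OF wiener_series_diff[OF wiener_space_series[OF F(1)] one]])
  then show thesis using that F unfolding evaluates_def wiener_algebra_def by blast
qed

text \<open>
  Besides the solution \<open>F = 1 + P (L F)\<close> itself, this yields \<open>W = F - L F\<close>, which is the other
  factor: its terms are \<open>P u - u\<close> with \<open>u = L (x\<^sub>k)\<close>, hence in the complementary frequencies and
  subject to the same bound.
\<close>

lemma projected_iterates_evaluate:
  assumes q: "0 \<le> q" "q < 1" and v: "L 1 \<in> wiener_space \<beta>"
    and L: "\<And>u. u \<in> wiener_space \<beta> \<Longrightarrow> L u \<in> wiener_space \<beta> \<and> wiener_norm \<beta> (L u) \<le> q * wiener_norm \<beta> u"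
    and w: "fps_nth w 0 = 1" "\<And>k. fps_nth w (Suc k) =
      projected_iterates Z L 1 (Suc k) - L (projected_iterates Z L 1 k)"
  obtains F W where "evaluates (Abs_fps (projected_iterates Z L 1)) F" "F \<in> wiener_algebra"
      "F - 1 \<in> frequencies_in Z"
    and "evaluates w W" "W \<in> wiener_algebra" "W - 1 \<in> frequencies_in (- Z)"
proof -
  define x where "x = projected_iterates Z L 1"
  define C where "C = wiener_norm \<beta> (L 1)"
  have u: "L (x k) \<in> wiener_space \<beta>" "wiener_norm \<beta> (L (x k)) \<le> C * q ^ k" for k
    using projected_iterates_bound[where L = L, OF v q(1) L] by (auto simp: x_def C_def)
  note p = frequency_part[OF u(1), where Z = Z]
  note bound = order_trans[OF p(3) u(2)] order_trans[OF p(6) u(2)]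
  have x: "x 0 = 1" "x (Suc k) = frequency_part Z (L (x k))" for k by (simp_all add: x_def)
  have w': "fps_nth w (Suc k) = frequency_part Z (L (x k)) - L (x k)" for k
    using w(2) by (simp add: x_def)
  obtain F where F: "evaluates (Abs_fps x) F" "F \<in> wiener_algebra" "F - 1 \<in> frequencies_in Z"
    by (rule geometric_evaluates[of "Abs_fps x" \<beta> C q Z])
      (use p q x bound in auto)
  obtain W where W: "evaluates w W" "W \<in> wiener_algebra" "W - 1 \<in> frequencies_in (- Z)"
    by (rule geometric_evaluates[of w \<beta> C q "- Z"])
      (use p q w(1) w' bound in auto)
  show thesis using that F W by (simp add: x_def)
qed

section \<open>The factorization\<close>

text \<open>
  The factors are \<open>m = a x\<close> and \<open>p = y a\<close>, the values at \<open>X = 1\<close> of the series \<open>(1 - c X) x\<close> and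
  \<open>y (1 - c X)\<close>. Their inverses \<open>y\<close> and \<open>x\<close> also provide the inverse \<open>x y\<close> of \<open>a\<close>.
\<close>

theorem canonical_factorization_near_one:
  assumes sub: "X (h \<alpha>) \<subseteq> X \<beta>" and \<alpha>: "1 - a \<in> wiener_space \<alpha>" and \<beta>: "1 - a \<in> wiener_space \<beta>"
    and small: "A \<beta> \<alpha> * wiener_norm \<alpha> (1 - a) < 1" and a: "a \<in> wiener_algebra"
  shows "has_canonical_factorization wiener_algebra wiener_plus wiener_minus0 a"
proof -
  define c where "c = 1 - a"
  define q where "q = A \<beta> \<alpha> * wiener_norm \<alpha> c"
  have c: "c \<in> wiener_space \<alpha>" "c \<in> wiener_space \<beta>" using \<alpha> \<beta> by (auto simp: c_def)
  have q: "0 \<le> q" "q < 1"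
    using small wiener_norm_nonneg[OF c(1)] A_pos[OF sub] by (auto simp: q_def c_def)
  have L: "c * u \<in> wiener_space \<beta> \<and> wiener_norm \<beta> (c * u) \<le> q * wiener_norm \<beta> u"
    and R: "u * c \<in> wiener_space \<beta> \<and> wiener_norm \<beta> (u * c) \<le> q * wiener_norm \<beta> u"
    if "u \<in> wiener_space \<beta>" for u
    using wiener_mult_bound[OF sub c(1) that] by (auto simp: q_def)
  define x where "x = Abs_fps (projected_iterates {..<0} (\<lambda>u. c * u) 1)"
  define y where "y = Abs_fps (projected_iterates {0..} (\<lambda>u. u * c) 1)"
  define T where "T = one_minus_X c"
  have T0: "fps_nth T 0 = 1" by (simp add: T_def one_minus_X_def)
  have compl: "- {..<0} = {0::int..}" "- {0..} = {..<0::int}" by auto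
  obtain x1 m where x1: "evaluates x x1" "x1 \<in> wiener_algebra" "x1 - 1 \<in> wiener_plus"
    and m: "evaluates (T * x) m" "m \<in> wiener_algebra" "m - 1 \<in> wiener_minus0"
    by (rule projected_iterates_evaluate[OF q, of "\<lambda>u. c * u" \<beta> "T * x" "{..<0}"])
      (use c L in \<open>auto simp: x_def T0[unfolded T_def] T_def one_minus_X_mult_nth wiener_plus_eq
        wiener_minus0_eq compl simp del: projected_iterates.simps(2)\<close>)
  obtain y1 p where y1: "evaluates y y1" "y1 \<in> wiener_algebra" "y1 - 1 \<in> wiener_minus0"
    and p: "evaluates (y * T) p" "p \<in> wiener_algebra" "p - 1 \<in> wiener_plus"
    by (rule projected_iterates_evaluate[OF q, of "\<lambda>u. u * c" \<beta> "y * T" "{0..}"])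
      (use c R in \<open>auto simp: y_def T0[unfolded T_def] T_def one_minus_X_mult_nth wiener_plus_eq
        wiener_minus0_eq compl simp del: projected_iterates.simps(2)\<close>)
  have part: "fps_nth x k \<in> frequencies_in {..<0}" "fps_nth (T * x) k \<in> frequencies_in {0..}"
    "fps_nth y k \<in> frequencies_in {0..}" "fps_nth (y * T) k \<in> frequencies_in {..<0}"
    if pos: "k > 0" for k
  proof -
    obtain j where k: "k = Suc j" using pos by (cases k) auto
    have "c * projected_iterates {..<0} (\<lambda>u. c * u) 1 j \<in> wiener_space \<beta>"
      "projected_iterates {0..} (\<lambda>u. u * c) 1 j * c \<in> wiener_space \<beta>"
      using projected_iterates_bound[of "\<lambda>u. c * u" 1 \<beta> q] c L q
        projected_iterates_bound[of "\<lambda>u. u * c" 1 \<beta> q] R by auto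
    note F = frequency_part[OF this(1), of "{..<0}"] frequency_part[OF this(2), of "{0..}"]
    show "fps_nth x k \<in> frequencies_in {..<0}" "fps_nth (T * x) k \<in> frequencies_in {0..}"
      "fps_nth y k \<in> frequencies_in {0..}" "fps_nth (y * T) k \<in> frequencies_in {..<0}"
      using F by (simp_all add: k x_def y_def T_def one_minus_X_mult_nth compl)
  qed
  have "frequencies_in {..<0} \<inter> frequencies_in {0..} \<subseteq> {0}" by (rule frequencies_in_disjoint) auto
  note formal = fps_canonical_factorization
    [OF zero_in_frequencies_in frequencies_in_add frequencies_in_mult
        zero_in_frequencies_in frequencies_in_add frequencies_in_mult this T0 _ _
        part(1) part(4) part(3) part(2)]
  \<comment> \<open>The series for \<open>p * x1\<close>, \<open>x1 * p\<close>, \<open>y1 * m\<close> and \<open>m * y1\<close> have the value \<open>1\<close>, like the series \<open>1\<close>.\<close>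
  have "(y * T) * x = 1" "x * (y * T) = 1" "y * (T * x) = 1" "(T * x) * y = 1"
    by (rule formal; simp add: x_def y_def)+
  then have inverse: "p * x1 = 1" "x1 * p = 1" "y1 * m = 1" "m * y1 = 1"
    using evaluates_mult[OF p(1) x1(1)] evaluates_mult[OF x1(1) p(1)]
      evaluates_mult[OF y1(1) m(1)] evaluates_mult[OF m(1) y1(1)]
    by (auto intro: evaluates_unique[OF _ evaluates_one])
  have T: "evaluates T a"
    using evaluates_one_minus_X[of c] c unfolding wiener_algebra_def by (auto simp: T_def c_def)
  have ax: "a * x1 = m" by (rule evaluates_unique[OF evaluates_mult[OF T x1(1)] m(1)])
  have ya: "y1 * a = p" by (rule evaluates_unique[OF evaluates_mult[OF y1(1) T] p(1)])
  have "a * (x1 * y1) = 1" using ax inverse by (simp add: mult.assoc[symmetric])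
  moreover have "(x1 * y1) * a = 1" using ya inverse by (simp add: mult.assoc)
  ultimately have "a \<in> GL wiener_algebra"
    using a wiener_algebra_mult[OF x1(2) y1(2)] unfolding GL_def by blast
  moreover have "a = m * p"
    using inverse(2) by (simp add: ax[symmetric] mult.assoc)
  moreover have "m \<in> GL wiener_algebra" "p \<in> GL wiener_algebra"
    using inverse x1 y1 m p unfolding GL_def by blast+
  moreover have "inverse_in wiener_algebra p = x1" "inverse_in wiener_algebra m = y1"
    using inverse x1(2) y1(2) by (auto intro: inverse_in_eq)
  ultimately show ?thesis
    unfolding has_canonical_factorization_def using x1(3) y1(3) m(3) p(3) by metis
qed

end

theorem corollary6p3:
  fixes scale :: "complex \<Rightarrow> 'a::{ring, monoid_mult} \<Rightarrow> 'a"
    and X :: "'i \<Rightarrow> 'a set" and nrm :: "'i \<Rightarrow> 'a \<Rightarrow> real"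
    and h :: "'i \<Rightarrow> 'i" and A :: "'i \<Rightarrow> 'i \<Rightarrow> real"
    and a :: "real \<Rightarrow> 'a"
  defines "U \<equiv> banach_inductive_limit.wiener_algebra scale X nrm"
    and "Y \<equiv> banach_inductive_limit.wiener_space scale X nrm"
    and "Ynorm \<equiv> banach_inductive_limit.wiener_norm scale X nrm"
    and "Uplus \<equiv> banach_inductive_limit.wiener_plus scale X nrm"
    and "Uminus0 \<equiv> banach_inductive_limit.wiener_minus0 scale X nrm"
  assumes "unital_strong_algebra scale X nrm h A"
    and "a \<in> U"
    and "\<exists>\<alpha> \<beta>. X (h \<alpha>) \<subseteq> X \<beta> \<and> 1 - a \<in> Y \<alpha> \<and> 1 - a \<in> Y \<beta> \<and> A \<beta> \<alpha> * Ynorm \<alpha> (1 - a) < 1"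
  shows "has_canonical_factorization U Uplus Uminus0 a"
proof -
  interpret unital_strong_algebra scale X nrm h A by fact
  obtain \<alpha> \<beta> where "X (h \<alpha>) \<subseteq> X \<beta>" "1 - a \<in> wiener_space \<alpha>" "1 - a \<in> wiener_space \<beta>"
    "A \<beta> \<alpha> * wiener_norm \<alpha> (1 - a) < 1"
    using assms(8) unfolding Y_def Ynorm_def by blast
  then show ?thesis
    using assms(7) unfolding U_def Uplus_def Uminus0_def
    by (rule canonical_factorization_near_one)
qed

end
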